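(* Let $h>0$ and let $\mathbf{v}\in C^{2}\left([0,T],l^{\infty}\right)$ be the solution of $$\frac{d^{2}\mathbf{v}}{dt^{2}} =D^{+}D^{-}\big(\boldsymbol{\beta}_{h}\ast f(\mathbf{v})\big)$$ with initial values $\mathbf{v}(0),\ \mathbf{v}^{\prime}(0)$. For a positive integer $N$ let $$\delta=\sup \big\{ \left\vert v_{i}(t)\right\vert : t\in \left[ 0,T\right] ,\ \left\vert i\right\vert >N\big\} \quad\text{and}\quad \epsilon (\delta )=\max_{\left\vert z\right\vert \leq \delta } \left\vert f(z)\right\vert .$$ Then there exist $\epsilon_0>0$ and $C>0$, independent of $N$, such that whenever $\epsilon(\delta)\le\epsilon_0$, the solution $\mathbf{v}^{N}=(v_i^N)_{-N\le i\le N}$ of the truncated system $$\frac{d^{2}v_{i}^{N}}{dt^{2}}=\sum_{j=-N}^{N}h\,(D^{+}D^{-}\boldsymbol{\beta}_h)_{i-j}\,f(v_{j}^{N}),\qquad -N\leq i\leq N,$$ with initial values $\mathbf{v}^{N}(0)=\mathcal{T}^{N}\mathbf{v}(0)$, $(\mathbf{v}^{N})^{\prime}(0)=\mathcal{T}^{N}\mathbf{v}^{\prime}(0)$ exists for times $t\in [0,T]$ and $$\left\vert v_{i}^{N}(t)-v_{i}(t)\right\vert+\left\vert (v_{i}^{N})^{\prime}(t)-(v_{i})^{\prime}(t)\right\vert \leq C\epsilon (\delta ),\qquad t\in [0,T],$$ for all $-N\leq i \leq N$.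
   Context: Standing assumptions: $\beta:\mathbb{R}\to\mathbb{R}$ is even with $\int_{\mathbb{R}}\beta(x)\,dx=1$, $\beta\in W^{1,1}(\mathbb{R})$ (identified with its continuous representative), and its second distributional derivative $\beta''=\mu$ is a finite Borel measure on $\mathbb{R}$. The function $f:\mathbb{R}\to\mathbb{R}$ is locally Lipschitz with $f(0)=0$. Sequences: $\mathbf{u}=(u_i)_{i\in\mathbb{Z}}$ denotes a two-sided infinite real sequence; $l^\infty=l^\infty(\mathbb{Z})$ with $\Vert\mathbf{u}\Vert_{l^\infty}=\sup_{i\in\mathbb{Z}}|u_i|$. The kernel restriction is $\boldsymbol{\beta}_h=(\beta(ih))_{i\in\mathbb{Z}}$ and $f(\mathbf{v})=(f(v_i))_{i\in\mathbb{Z}}$. The discrete convolution is $(\mathbf{u}\ast\mathbf{v})_i=\sum_{j\in\mathbb{Z}}h\,u_{i-j}v_j$. The difference operators are $(D^+\mathbf{u})_i=\frac1h(u_{i+1}-u_i)$, $(D^-\mathbf{u})_i=\frac1h(u_i-u_{i-1})$, so $(D^+D^-\mathbf{u})_i=\frac1{h^2}(u_{i+1}-2u_i+u_{i-1})$. The truncation operator $\mathcal{T}^N:l^\infty\to\mathbb{R}^{2N+1}$ is $\mathcal{T}^N\mathbf{v}=(v_{-N},v_{-N+1},\ldots,v_{N-1},v_N)$. *)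

theory Defs
  imports "HOL-Analysis.Analysis"
begin

text \<open>The space of bounded two-sided sequences is \<^typ>\<open>int \<Rightarrow>\<^sub>C real\<close>: the topology of
  \<^typ>\<open>int\<close> is discrete, so these are all the bounded functions, and the norm is the supremum norm.\<close>

definition test_function :: "(real \<Rightarrow> real) \<Rightarrow> bool" where
  "test_function \<phi> \<longleftrightarrow>
     (\<forall>n. (deriv ^^ n) \<phi> differentiable_on UNIV) \<and> compact (closure {x. \<phi> x \<noteq> 0})"

definition weak_derivative :: "(real \<Rightarrow> real) \<Rightarrow> (real \<Rightarrow> real) \<Rightarrow> bool" where
  "weak_derivative u g \<longleftrightarrow>
     (\<forall>\<phi>. test_function \<phi> \<longrightarrow>
        (LINT x|lborel. u x * deriv \<phi> x) = - (LINT x|lborel. g x * \<phi> x))"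

definition sobolev_W11 :: "(real \<Rightarrow> real) \<Rightarrow> bool" where
  "sobolev_W11 u \<longleftrightarrow>
     integrable lborel u \<and> (\<exists>g. integrable lborel g \<and> weak_derivative u g)"

text \<open>A finite signed Borel measure is given as a difference \<open>P - Q\<close> of two finite
  nonnegative Borel measures; by the Jordan decomposition this covers all of them.
  A sign is needed: the second derivative of an integrable kernel has total mass zero.\<close>

definition finite_borel_measure :: "real measure \<Rightarrow> bool" where
  "finite_borel_measure P \<longleftrightarrow> finite_measure P \<and> sets P = sets borel"

definition second_derivative_measure ::
    "(real \<Rightarrow> real) \<Rightarrow> real measure \<Rightarrow> real measure \<Rightarrow> bool" where
  "second_derivative_measure u P Q \<longleftrightarrow>
     finite_borel_measure P \<and> finite_borel_measure Q \<and>
     (\<forall>\<phi>. test_function \<phi> \<longrightarrow>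
        (LINT x|lborel. u x * deriv (deriv \<phi>) x) = (LINT x|P. \<phi> x) - (LINT x|Q. \<phi> x))"

definition forward_diff :: "real \<Rightarrow> (int \<Rightarrow> real) \<Rightarrow> int \<Rightarrow> real" where
  "forward_diff h u i = (u (i + 1) - u i) / h"

definition backward_diff :: "real \<Rightarrow> (int \<Rightarrow> real) \<Rightarrow> int \<Rightarrow> real" where
  "backward_diff h u i = (u i - u (i - 1)) / h"

definition grid_restriction :: "real \<Rightarrow> (real \<Rightarrow> real) \<Rightarrow> int \<Rightarrow> real" where
  "grid_restriction h \<beta> i = \<beta> (of_int i * h)"

definition discrete_conv :: "real \<Rightarrow> (int \<Rightarrow> real) \<Rightarrow> (int \<Rightarrow> real) \<Rightarrow> int \<Rightarrow> real" where
  "discrete_conv h u v i = (\<Sum>\<^sub>\<infinity>j\<in>UNIV. h * u (i - j) * v j)"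

definition truncation :: "nat \<Rightarrow> (int \<Rightarrow>\<^sub>C real) \<Rightarrow> int \<Rightarrow> real" where
  "truncation N u = restrict (apply_bcontfun u) {- int N..int N}"

definition C2_derivatives_on ::
    "real set \<Rightarrow> (real \<Rightarrow> 'a::real_normed_vector) \<Rightarrow> (real \<Rightarrow> 'a) \<Rightarrow> (real \<Rightarrow> 'a) \<Rightarrow> bool" where
  "C2_derivatives_on S v v' v'' \<longleftrightarrow>
     (\<forall>t\<in>S. (v has_vector_derivative v' t) (at t within S)) \<and>
     (\<forall>t\<in>S. (v' has_vector_derivative v'' t) (at t within S)) \<and>
     continuous_on S v''"

definition solves_lattice_system ::
    "(real \<Rightarrow> real) \<Rightarrow> (real \<Rightarrow> real) \<Rightarrow> real \<Rightarrow> real \<Rightarrow>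
     (real \<Rightarrow> int \<Rightarrow>\<^sub>C real) \<Rightarrow> (real \<Rightarrow> int \<Rightarrow>\<^sub>C real) \<Rightarrow> bool" where
  "solves_lattice_system \<beta> f h T v v' \<longleftrightarrow>
     (\<exists>v''. C2_derivatives_on {0..T} v v' v'' \<and>
        (\<forall>t\<in>{0..T}. \<forall>i. apply_bcontfun (v'' t) i =
           forward_diff h (backward_diff h
             (discrete_conv h (grid_restriction h \<beta>) (\<lambda>j. f (apply_bcontfun (v t) j)))) i))"

text \<open>Vectors with components \<open>-N, \<dots>, N\<close> are functions on \<^typ>\<open>int\<close> of which only the
  values on \<open>{-N..N}\<close> are used; \<open>a\<close> and \<open>b\<close> are the initial values of \<open>w\<close> and of its
  derivative \<open>w'\<close>.\<close>

definition solves_truncated_system ::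
    "(real \<Rightarrow> real) \<Rightarrow> (real \<Rightarrow> real) \<Rightarrow> real \<Rightarrow> real \<Rightarrow> nat \<Rightarrow> (int \<Rightarrow> real) \<Rightarrow> (int \<Rightarrow> real) \<Rightarrow>
     (real \<Rightarrow> int \<Rightarrow> real) \<Rightarrow> (real \<Rightarrow> int \<Rightarrow> real) \<Rightarrow> bool" where
  "solves_truncated_system \<beta> f h T N a b w w' \<longleftrightarrow>
     (\<forall>i\<in>{- int N..int N}. w 0 i = a i \<and> w' 0 i = b i \<and>
        (\<forall>t\<in>{0..T}.
           ((\<lambda>s. w s i) has_real_derivative w' t i) (at t within {0..T}) \<and>
           ((\<lambda>s. w' s i) has_real_derivative
              (\<Sum>j = - int N..int N.
                 h * forward_diff h (backward_diff h (grid_restriction h \<beta>)) (i - j) * f (w t j)))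
             (at t within {0..T})))"

definition tail_sup :: "real \<Rightarrow> (real \<Rightarrow> int \<Rightarrow>\<^sub>C real) \<Rightarrow> nat \<Rightarrow> real" where
  "tail_sup T v N = Sup {\<bar>apply_bcontfun (v t) i\<bar> |t i. t \<in> {0..T} \<and> \<bar>i\<bar> > int N}"

text \<open>For continuous \<open>f\<close> and \<open>d \<ge> 0\<close> this supremum is attained, so it is the maximum.\<close>

definition max_abs_on :: "(real \<Rightarrow> real) \<Rightarrow> real \<Rightarrow> real" where
  "max_abs_on f d = Sup {\<bar>f z\<bar> |z. \<bar>z\<bar> \<le> d}"

end

theory Submission
  imports Defs
begin

text \<open>Since \<open>\<beta>\<close> is in \<open>W\<^sup>1\<^sup>,\<^sup>1\<close>, its values on a grid of mesh \<open>h\<close> are absolutely summable: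
  \<open>\<bar>\<beta> x\<bar>\<close> is at most the mean of \<open>\<bar>\<beta>\<bar>\<close> over \<open>{x..x + h}\<close> plus the integral of the weak
  derivative over a slightly longer interval. For fixed \<open>h\<close> the kernel \<open>D\<^sup>+D\<^sup>-\<beta>\<^sub>h\<close>
  is therefore summable, with some mass \<open>\<kappa>\<close>, and \<open>\<bold>v\<close> solves the truncated system up to a defect
  \<open>\<kappa> \<epsilon>(\<delta>)\<close>. Replace \<open>f\<close> outside the range of \<open>\<bold>v\<close> enlarged by 1 so that it becomes globally
  Lipschitz. The modified truncated system has a global solution, and a Gronwall argument with constants
  independent of \<open>N\<close> keeps it within \<open>O(\<epsilon>(\<delta>))\<close> of \<open>\<bold>v\<close>. If \<open>\<epsilon>(\<delta>)\<close> is small it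
  never leaves the enlarged range, hence solves the original system, and any other solution
  agrees with it by uniqueness.\<close>

section \<open>Second-order Gronwall estimate and global Picard--Lindelof\<close>

text \<open>Mean value inequality with a moving majorant. The endpoints enter only through
  continuity, so one-sided derivatives suffice there.\<close>

lemma real_derivative_bound:
  fixes g :: "real \<Rightarrow> real"
  assumes "0 \<le> t"
    and g: "\<And>s. s \<in> {0..t} \<Longrightarrow> (g has_real_derivative g' s) (at s within {0..t})"
    and G: "\<And>s. s \<in> {0..t} \<Longrightarrow> (G has_real_derivative G' s) (at s within {0..t})"
    and le: "\<And>s. s \<in> {0..t} \<Longrightarrow> \<bar>g' s\<bar> \<le> G' s"
  shows "\<bar>g t - g 0\<bar> \<le> G t - G 0"
proof (cases "t = 0")
  case False
  have within: "at s within {0..t} = at s" if "0 < s" "s < t" for s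
    using that by (simp add: at_within_Icc_at)
  show ?thesis
    unfolding real_norm_def [symmetric]
  proof (rule differentiable_bound_general [of 0 t g G g' G'])
    show "continuous_on {0..t} g" "continuous_on {0..t} G"
      using DERIV_continuous_on [of "{0..t}" g g'] DERIV_continuous_on [of "{0..t}" G G'] g G by blast+
  next
    fix s assume "0 < s" "s < t"
    then show "(g has_vector_derivative g' s) (at s)" "(G has_vector_derivative G' s) (at s)"
      "norm (g' s) \<le> G' s"
      using g [of s] G [of s] le [of s] within [of s]
      by (auto simp: has_real_derivative_iff_has_vector_derivative)
  qed (use False \<open>0 \<le> t\<close> in auto)
qed simp

text \<open>The weight \<open>exp (- \<lambda> t)\<close> turns the double time integral into a contraction.\<close>
lemma second_order_gronwall:
  fixes e e' e'' :: "'i \<Rightarrow> real \<Rightarrow> real"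
  assumes fin: "finite I" and a: "0 \<le> a" and b: "0 \<le> b"
    and init: "\<And>i. i \<in> I \<Longrightarrow> e i 0 = 0" "\<And>i. i \<in> I \<Longrightarrow> e' i 0 = 0"
    and e: "\<And>i t. i \<in> I \<Longrightarrow> t \<in> {0..T} \<Longrightarrow> (e i has_real_derivative e' i t) (at t within {0..T})"
    and e': "\<And>i t. i \<in> I \<Longrightarrow> t \<in> {0..T} \<Longrightarrow> (e' i has_real_derivative e'' i t) (at t within {0..T})"
    and bound: "\<And>i t m. i \<in> I \<Longrightarrow> t \<in> {0..T} \<Longrightarrow> (\<forall>j\<in>I. \<bar>e j t\<bar> \<le> m) \<Longrightarrow> \<bar>e'' i t\<bar> \<le> a * m + b"
    and i: "i \<in> I" and t: "t \<in> {0..T}"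
  shows "\<bar>e i t\<bar> \<le> (2 * T\<^sup>2 * exp ((1 + a) * T) + T) * b"
    and "\<bar>e' i t\<bar> \<le> (2 * T\<^sup>2 * exp ((1 + a) * T) + T) * b"
proof -
  have T: "0 \<le> T" using t by auto
  \<comment> \<open>This rate gives \<open>a / l \<le> 1\<close> and
    \<open>a / l\<^sup>2 \<le> 1 / 2\<close>; the second quotient is the contraction factor of the
    double time integral.\<close>
  define l where "l = 1 + a"
  have l: "l > 0" and al: "a / l \<le> 1"
    using a by (auto simp: l_def)
  have "2 * a \<le> l\<^sup>2" by (simp add: l_def power2_sum)
  then have al2: "a / l\<^sup>2 \<le> 1 / 2"
    using l by (simp add: pos_divide_le_eq)
  \<comment> \<open>One weighted supremum over all components and all times controls the whole
    coupled system. It is finite because \<open>I\<close> is finite and \<open>{0..T}\<close> is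
    compact.\<close>
  define S where "S = (\<lambda>(j, s). exp (- l * s) * \<bar>e j s\<bar>) ` (I \<times> {0..T})"
  have "compact ((\<lambda>s. exp (- l * s) * \<bar>e j s\<bar>) ` {0..T})" if "j \<in> I" for j
    using e [OF that] by (intro compact_continuous_image continuous_intros DERIV_continuous_on) auto
  then have "bounded (\<Union>j\<in>I. (\<lambda>s. exp (- l * s) * \<bar>e j s\<bar>) ` {0..T})"
    using fin by (auto intro: compact_imp_bounded)
  also have "(\<Union>j\<in>I. (\<lambda>s. exp (- l * s) * \<bar>e j s\<bar>) ` {0..T}) = S"
    by (auto simp: S_def)
  finally have bdd: "bdd_above S" by (rule bounded_imp_bdd_above)
  have ne: "S \<noteq> {}" using i t by (auto simp: S_def)
  define B where "B = Sup S"
  have B: "exp (- l * s) * \<bar>e j s\<bar> \<le> B" if "j \<in> I" "s \<in> {0..T}" for j s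
    unfolding B_def using that bdd by (intro cSup_upper) (auto simp: S_def)
  have "0 \<le> exp (- l * t) * \<bar>e i t\<bar>" by simp
  also have "\<dots> \<le> B" using B i t by blast
  finally have B0: "0 \<le> B" .
  have eB: "\<bar>e j s\<bar> \<le> B * exp (l * s)" if "j \<in> I" "s \<in> {0..T}" for j s
  proof -
    have "\<bar>e j s\<bar> = (exp (- l * s) * \<bar>e j s\<bar>) * exp (l * s)"
      by (simp add: exp_minus field_simps)
    also have "\<dots> \<le> B * exp (l * s)" using B [OF that] by (intro mult_right_mono) auto
    finally show ?thesis .
  qed
  have sub: "(g has_real_derivative d) (at s within {0..u})"
    if "(g has_real_derivative d) (at s within {0..T})" "u \<in> {0..T}" for g d s u
    using that by (auto intro: DERIV_subset)
  \<comment> \<open>The hypothesis \<open>bound\<close> is used at each time with its own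
    \<open>m\<close>, here the envelope \<open>B * exp (l * s)\<close>.\<close>
  have bound': "\<bar>e'' j s\<bar> \<le> a * B * exp (l * s) + b" if "j \<in> I" "s \<in> {0..T}" for j s
    using bound [of j s "B * exp (l * s)"] eB that by (auto simp: mult.assoc)
  \<comment> \<open>First of two time integrations. Each divides the exponential term by
    \<open>l\<close>; its value at time 0 has the favourable sign and is dropped.\<close>
  have e'B: "\<bar>e' j s\<bar> \<le> a * B * exp (l * s) / l + b * T" if j: "j \<in> I" and s: "s \<in> {0..T}" for j s
  proof -
    have "\<bar>e' j s - e' j 0\<bar> \<le> (a * B * exp (l * s) / l + b * s) - (a * B * exp (l * 0) / l + b * 0)"
    proof (rule real_derivative_bound [where g' = "e'' j" and G' = "\<lambda>s. a * B * exp (l * s) + b"])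
      show "0 \<le> s" using s by simp
    next
      fix r assume r: "r \<in> {0..s}"
      then have r': "r \<in> {0..T}" using s by auto
      show "(e' j has_real_derivative e'' j r) (at r within {0..s})"
        using sub e' j s r' by blast
      show "((\<lambda>s. a * B * exp (l * s) / l + b * s) has_real_derivative a * B * exp (l * r) + b) (at r within {0..s})"
        using l by (auto intro!: derivative_eq_intros)
      show "\<bar>e'' j r\<bar> \<le> a * B * exp (l * r) + b" using bound' j r' by blast
    qed
    moreover have "b * s \<le> b * T" using b s by (intro mult_left_mono) auto
    moreover have "0 \<le> a * B * exp (l * 0) / l" using a B0 l by simp
    ultimately show ?thesis using init j by auto
  qed
  have eB2: "\<bar>e j s\<bar> \<le> a * B * exp (l * s) / l\<^sup>2 + b * T\<^sup>2" if j: "j \<in> I" and s: "s \<in> {0..T}" for j s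
  proof -
    have "\<bar>e j s - e j 0\<bar> \<le> (a * B * exp (l * s) / l\<^sup>2 + b * T * s) - (a * B * exp (l * 0) / l\<^sup>2 + b * T * 0)"
    proof (rule real_derivative_bound [where g' = "e' j" and G' = "\<lambda>s. a * B * exp (l * s) / l + b * T"])
      show "0 \<le> s" using s by simp
    next
      fix r assume r: "r \<in> {0..s}"
      then have r': "r \<in> {0..T}" using s by auto
      show "(e j has_real_derivative e' j r) (at r within {0..s})"
        using sub e j s r' by blast
      show "((\<lambda>s. a * B * exp (l * s) / l\<^sup>2 + b * T * s) has_real_derivative a * B * exp (l * r) / l + b * T) (at r within {0..s})"
        using l by (auto intro!: derivative_eq_intros simp: power2_eq_square)
      show "\<bar>e' j r\<bar> \<le> a * B * exp (l * r) / l + b * T" using e'B j r' by blast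
    qed
    moreover have "b * T * s \<le> b * T\<^sup>2"
      unfolding power2_eq_square mult.assoc using b s T by (intro mult_left_mono) auto
    moreover have "0 \<le> a * B * exp (l * 0) / l\<^sup>2" using a B0 l by simp
    ultimately show ?thesis using init j by auto
  qed
  \<comment> \<open>After two integrations the weighted supremum bounds itself with factor 1/2, so
    it can be absorbed into the left side.\<close>
  have "B \<le> B / 2 + b * T\<^sup>2"
    unfolding B_def
  proof (rule cSup_least [OF ne])
    fix x assume "x \<in> S"
    then obtain j s where x: "x = exp (- l * s) * \<bar>e j s\<bar>" and j: "j \<in> I" and s: "s \<in> {0..T}"
      by (auto simp: S_def)
    have "x \<le> exp (- l * s) * (a * B * exp (l * s) / l\<^sup>2 + b * T\<^sup>2)"
      unfolding x using eB2 [OF j s] by (intro mult_left_mono) auto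
    also have "\<dots> = (a / l\<^sup>2) * B + exp (- l * s) * (b * T\<^sup>2)"
      by (simp add: exp_minus field_simps)
    also have "\<dots> \<le> (1 / 2) * B + 1 * (b * T\<^sup>2)"
      using al2 B0 b l s by (intro add_mono mult_right_mono) auto
    finally show "x \<le> Sup S / 2 + b * T\<^sup>2" by (simp add: B_def)
  qed
  then have B2: "B \<le> 2 * b * T\<^sup>2" by simp
  have expt: "exp (l * t) \<le> exp (l * T)" using l t by simp
  then have BB: "B * exp (l * t) \<le> 2 * b * T\<^sup>2 * exp (l * T)"
    using B2 B0 b by (intro mult_mono) auto
  have "\<bar>e i t\<bar> \<le> 2 * b * T\<^sup>2 * exp (l * T)" using eB [OF i t] BB by simp
  also have "\<dots> \<le> (2 * T\<^sup>2 * exp (l * T) + T) * b" using T b by (simp add: algebra_simps)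
  finally show "\<bar>e i t\<bar> \<le> (2 * T\<^sup>2 * exp ((1 + a) * T) + T) * b" by (simp add: l_def)
  have "\<bar>e' i t\<bar> \<le> (a / l) * (B * exp (l * t)) + b * T" using e'B [OF i t] by simp
  also have "\<dots> \<le> 1 * (B * exp (l * t)) + b * T"
    using al B0 by (intro add_mono mult_right_mono order_refl) auto
  also have "\<dots> \<le> (2 * T\<^sup>2 * exp (l * T) + T) * b" using BB by (simp add: algebra_simps)
  finally show "\<bar>e' i t\<bar> \<le> (2 * T\<^sup>2 * exp ((1 + a) * T) + T) * b" by (simp add: l_def)
qed

text \<open>Banach's fixed point theorem for the Picard map in an exponentially weighted norm. The
  weight makes the map contract by 1/2 on all of \<open>{0..T}\<close> at once, so no short-time
  solutions have to be glued together.\<close>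

lemma global_lipschitz_ode_solution:
  fixes F :: "'a::banach \<Rightarrow> 'a"
  assumes F: "L-lipschitz_on UNIV F" and T: "0 \<le> T"
  shows "\<exists>x. x 0 = x0 \<and> (\<forall>t\<in>{0..T}. (x has_vector_derivative F (x t)) (at t within {0..T}))"
proof -
  have L: "0 \<le> L" using F lipschitz_on_nonneg by blast
  have Fc: "continuous_on A F" for A
    using lipschitz_on_continuous_on [OF F] continuous_on_subset by blast
  define l where "l = 2 * L + 1"
  have l: "l > 0" and Ll: "L / l \<le> 1 / 2" using L by (auto simp: l_def)
  \<comment> \<open>The fixed point is sought among bounded continuous functions on the whole line.
    Composing with this retraction onto \<open>{0..T}\<close> extends the Picard iterate by
    constants.\<close>
  define clip where "clip t = max 0 (min t T)" for t
  have clip: "clip t \<in> {0..T}" and clip_id: "t \<in> {0..T} \<Longrightarrow> clip t = t" for t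
    using T by (auto simp: clip_def)
  have clip_cont: "continuous_on UNIV clip"
    unfolding clip_def by (intro continuous_intros)
  \<comment> \<open>The unknown \<open>y\<close> stands for the solution multiplied by
    \<open>exp (- l * t)\<close>, so that the ordinary supremum distance of \<open>y\<close> is the
    weighted distance of the solution.\<close>
  define rhs where "rhs y t = F (exp (l * t) *\<^sub>R apply_bcontfun y t)" for y t
  have rhs_cont: "continuous_on A (rhs y)" for A y
    unfolding rhs_def
    by (rule continuous_on_compose2 [OF Fc [of UNIV]]) (auto intro!: continuous_intros)
  have rhs_int: "rhs y integrable_on {0..t}" for y t
    by (intro integrable_continuous_real rhs_cont)
  define P where "P y t = exp (- l * t) *\<^sub>R (x0 + integral {0..t} (rhs y))" for y t
  have P_cont: "continuous_on {0..T} (P y)" for y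
    unfolding P_def by (intro continuous_intros indefinite_integral_continuous_1 rhs_int)
  have P_clip: "(\<lambda>t. P y (clip t)) \<in> bcontfun" for y
  proof -
    have "continuous_on UNIV (\<lambda>t. P y (clip t))"
      using clip by (intro continuous_on_compose2 [OF P_cont clip_cont]) auto
    moreover have "bounded (P y ` {0..T})"
      by (intro compact_imp_bounded compact_continuous_image P_cont) auto
    then have "bounded (range (\<lambda>t. P y (clip t)))"
      by (rule bounded_subset) (use clip in auto)
    ultimately show ?thesis by (simp add: bcontfun_def)
  qed
  define \<Phi> where "\<Phi> y = Bcontfun (\<lambda>t. P y (clip t))" for y
  have \<Phi>: "apply_bcontfun (\<Phi> y) t = P y (clip t)" for y t
    unfolding \<Phi>_def using P_clip by (simp add: Bcontfun_inverse)
  have contr: "dist (\<Phi> y) (\<Phi> z) \<le> 1 / 2 * dist y z" for y z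
  proof (rule dist_bound)
    fix t
    define s where "s = clip t"
    have s: "s \<in> {0..T}" unfolding s_def by (rule clip)
    have "((\<lambda>r. L * exp (l * r) * dist y z) has_integral
        L * exp (l * s) / l * dist y z - L * exp (l * 0) / l * dist y z) {0..s}"
      using l s by (intro fundamental_theorem_of_calculus)
        (auto intro!: derivative_eq_intros simp flip: has_real_derivative_iff_has_vector_derivative)
    note J = this
    have "norm (integral {0..s} (\<lambda>r. rhs y r - rhs z r)) \<le> integral {0..s} (\<lambda>r. L * exp (l * r) * dist y z)"
    proof (rule integral_norm_bound_integral)
      fix r assume "r \<in> {0..s}"
      have "norm (rhs y r - rhs z r) \<le> L * dist (exp (l * r) *\<^sub>R apply_bcontfun y r) (exp (l * r) *\<^sub>R apply_bcontfun z r)"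
        unfolding rhs_def using lipschitz_onD [OF F] by (simp add: dist_norm)
      also have "\<dots> = L * (exp (l * r) * dist (apply_bcontfun y r) (apply_bcontfun z r))"
        by (simp add: dist_norm flip: scaleR_diff_right)
      also have "\<dots> \<le> L * (exp (l * r) * dist y z)"
        using L by (intro mult_left_mono dist_bounded) auto
      finally show "norm (rhs y r - rhs z r) \<le> L * exp (l * r) * dist y z" by (simp add: mult.assoc)
    qed (use J in \<open>auto intro!: integrable_diff rhs_int\<close>)
    also have "\<dots> = L * exp (l * s) / l * dist y z - L * exp (l * 0) / l * dist y z"
      using J by (rule integral_unique)
    also have "\<dots> \<le> L * exp (l * s) / l * dist y z" using L l by simp
    finally have N: "norm (integral {0..s} (\<lambda>r. rhs y r - rhs z r)) \<le> L * exp (l * s) / l * dist y z" .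
    have "P y s - P z s = exp (- l * s) *\<^sub>R integral {0..s} (\<lambda>r. rhs y r - rhs z r)"
      by (simp add: P_def integral_diff rhs_int algebra_simps)
    then have "dist (P y s) (P z s) = exp (- l * s) * norm (integral {0..s} (\<lambda>r. rhs y r - rhs z r))"
      by (simp add: dist_norm)
    also have "\<dots> \<le> exp (- l * s) * (L * exp (l * s) / l * dist y z)"
      using N by (intro mult_left_mono) auto
    also have "\<dots> = L / l * dist y z" by (simp add: exp_minus field_simps)
    also have "\<dots> \<le> 1 / 2 * dist y z" using Ll by (intro mult_right_mono) auto
    finally show "dist (apply_bcontfun (\<Phi> y) t) (apply_bcontfun (\<Phi> z) t) \<le> 1 / 2 * dist y z"
      by (simp add: \<Phi> s_def)
  qed
  have "\<exists>!y. \<Phi> y = y"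
    by (rule banach_fix_type [of "1 / 2"]) (use contr in auto)
  then obtain y where y: "\<Phi> y = y" by blast
  \<comment> \<open>Removing the weight from the fixed point gives the integral equation, which is
    then differentiated.\<close>
  define x where "x t = x0 + integral {0..t} (rhs y)" for t
  have yx: "exp (l * t) *\<^sub>R apply_bcontfun y t = x t" if "t \<in> {0..T}" for t
  proof -
    have "apply_bcontfun y t = P y t" using \<Phi> [of y t] y clip_id that by simp
    then show ?thesis by (simp add: P_def x_def exp_minus)
  qed
  have "(x has_vector_derivative F (x t)) (at t within {0..T})" if t: "t \<in> {0..T}" for t
  proof -
    have "(x has_vector_derivative 0 + rhs y t) (at t within {0..T})"
      unfolding x_def
      by (intro has_vector_derivative_add has_vector_derivative_const
          integral_has_vector_derivative rhs_cont t)
    then show ?thesis using yx [OF t] by (simp add: rhs_def)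
  qed
  moreover have "x 0 = x0" by (simp add: x_def)
  ultimately show ?thesis by blast
qed

section \<open>A smooth step\<close>

text \<open>Induction keeps every iterated derivative inside the family. Smoothness in the sense of
  \<open>test_function\<close> thus follows from first derivatives alone, without a formula for the
  higher ones.\<close>

lemma derivative_closed_iterated_deriv_differentiable:
  fixes \<F> :: "(real \<Rightarrow> real) set"
  assumes closed: "\<And>G. G \<in> \<F> \<Longrightarrow> \<exists>G'\<in>\<F>. \<forall>t. (G has_real_derivative G' t) (at t)"
    and G: "G \<in> \<F>"
  shows "(deriv ^^ n) G differentiable_on UNIV"
proof -
  have "(deriv ^^ n) G \<in> \<F>"
  proof (induction n)
    case (Suc n)
    then obtain G' where "G' \<in> \<F>" "\<And>t. ((deriv ^^ n) G has_real_derivative G' t) (at t)"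
      using closed by blast
    moreover from this(2) have "deriv ((deriv ^^ n) G) = G'"
      by (auto intro: DERIV_imp_deriv)
    ultimately show ?case by simp
  qed (simp add: G)
  then show ?thesis
    using closed by (meson differentiable_on_def has_field_derivative_imp_has_derivative
        differentiableI differentiable_at_withinI)
qed

text \<open>The chain rule contributes one factor \<open>1 / \<epsilon>\<close> per derivative. This
  carries smoothness from a unit step over to the difference of two rescaled steps that will serve
  as test function.\<close>

lemma iterated_deriv_affine_diff:
  fixes F :: "real \<Rightarrow> real"
  assumes F: "\<And>n. (deriv ^^ n) F differentiable_on UNIV" and "\<epsilon> \<noteq> 0"
  shows "(deriv ^^ n) (\<lambda>t. F ((t - x) / \<epsilon>) - F ((t - y) / \<epsilon>)) =
      (\<lambda>t. ((deriv ^^ n) F ((t - x) / \<epsilon>) - (deriv ^^ n) F ((t - y) / \<epsilon>)) / \<epsilon> ^ n)"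
proof (induction n)
  case (Suc n)
  have D: "((deriv ^^ n) F has_real_derivative deriv ((deriv ^^ n) F) s) (at s)" for s
    using F [of n] by (auto simp: differentiable_on_def DERIV_deriv_iff_real_differentiable)
  have "((\<lambda>t. ((deriv ^^ n) F ((t - x) / \<epsilon>) - (deriv ^^ n) F ((t - y) / \<epsilon>)) / \<epsilon> ^ n)
      has_real_derivative
        ((deriv ((deriv ^^ n) F) ((t - x) / \<epsilon>) * (1 / \<epsilon>) - deriv ((deriv ^^ n) F) ((t - y) / \<epsilon>) * (1 / \<epsilon>)) / \<epsilon> ^ n)) (at t)" for t
    by (intro DERIV_cdivide DERIV_diff DERIV_chain2 [OF D])
       (use \<open>\<epsilon> \<noteq> 0\<close> in \<open>auto intro!: derivative_eq_intros\<close>)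
  then have "deriv (\<lambda>t. ((deriv ^^ n) F ((t - x) / \<epsilon>) - (deriv ^^ n) F ((t - y) / \<epsilon>)) / \<epsilon> ^ n) t =
      (deriv ((deriv ^^ n) F) ((t - x) / \<epsilon>) * (1 / \<epsilon>) - deriv ((deriv ^^ n) F) ((t - y) / \<epsilon>) * (1 / \<epsilon>)) / \<epsilon> ^ n" for t
    by (rule DERIV_imp_deriv)
  then show ?case
    unfolding funpow.simps o_apply Suc.IH by (intro ext) (simp add: diff_divide_distrib)
qed simp

text \<open>The family is closed under differentiation, so all its members are smooth.\<close>
definition bump :: "real poly \<Rightarrow> nat \<Rightarrow> real \<Rightarrow> real" where
  "bump p k t = (if 0 < t \<and> t < 1
     then poly p t * inverse (t * (1 - t)) ^ k * exp (- inverse (t * (1 - t))) else 0)"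

text \<open>Reciprocal of the inequality \<open>(1 + x / n) ^ n \<le> exp x\<close> at
  \<open>x = inverse q\<close>. It makes the bump functions flat at the ends of the unit interval,
  whatever the negative power in front.\<close>

lemma exp_minus_inverse_le_power:
  fixes q :: real
  assumes "q > 0"
  shows "exp (- inverse q) \<le> real n ^ n * q ^ n"
proof (cases "n = 0")
  case False
  have pos: "inverse q > 0" using assms by simp
  have "(inverse q / real n) ^ n \<le> (1 + inverse q / real n) ^ n"
    using assms by (intro power_mono) auto
  also have "\<dots> \<le> exp (inverse q)"
    using pos False by (intro exp_ge_one_plus_x_over_n_power_n) linarith+
  finally have "inverse (exp (inverse q)) \<le> inverse ((inverse q / real n) ^ n)"
    using pos False by (intro le_imp_inverse_le) auto
  also have "inverse ((inverse q / real n) ^ n) = real n ^ n * q ^ n"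
    by (simp add: divide_inverse power_mult_distrib flip: power_inverse)
  finally show ?thesis by (simp add: exp_minus)
qed (use assms in simp)

text \<open>The exponential pays for \<open>k + 2\<close> powers of \<open>t * (1 - t)\<close>:
  \<open>k\<close> of them cancel the inverse powers, and the remaining two give a zero of second
  order at both ends.\<close>

lemma bump_bound:
  "\<exists>M. \<forall>t. 0 < t \<longrightarrow> t < 1 \<longrightarrow> \<bar>bump p k t\<bar> \<le> M * (t * (1 - t))\<^sup>2"
proof -
  have "compact (poly p ` {0..1})"
    by (intro compact_continuous_image continuous_intros) auto
  from compact_imp_bounded [OF this]
  obtain M where "\<forall>t\<in>{0..1}. \<bar>poly p t\<bar> \<le> M"
    unfolding bounded_iff by auto
  then have M: "\<bar>poly p t\<bar> \<le> M" if "t \<in> {0..1}" for t using that by blast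
  have "\<bar>bump p k t\<bar> \<le> M * real (k + 2) ^ (k + 2) * (t * (1 - t))\<^sup>2" if t: "0 < t" "t < 1" for t
  proof -
    define q where "q = t * (1 - t)"
    have q: "q > 0" using t by (simp add: q_def)
    have "\<bar>bump p k t\<bar> = \<bar>poly p t\<bar> * inverse q ^ k * exp (- inverse q)"
      using t q by (simp add: bump_def q_def abs_mult power_abs del: inverse_mult_distrib)
    also have "\<dots> \<le> M * inverse q ^ k * (real (k + 2) ^ (k + 2) * q ^ (k + 2))"
      using M [of t] M [of 0] t q
      by (intro mult_mono mult_right_mono exp_minus_inverse_le_power) auto
    also have "\<dots> = M * real (k + 2) ^ (k + 2) * (inverse q ^ k * q ^ k) * q\<^sup>2"
      by (simp only: power_add mult.assoc mult.left_commute mult.commute)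
    also have "inverse q ^ k * q ^ k = 1"
      using q by (simp flip: power_mult_distrib)
    finally show ?thesis by (simp add: q_def)
  qed
  then show ?thesis by blast
qed

lemma quadratic_bound_has_derivative_0:
  fixes G :: "real \<Rightarrow> real"
  assumes "\<And>t. \<bar>G t\<bar> \<le> M * (t - a)\<^sup>2"
  shows "(G has_real_derivative 0) (at a)"
proof -
  have "G a = 0" using assms [of a] by simp
  have lim: "((\<lambda>t. M * \<bar>t - a\<bar>) \<longlongrightarrow> M * \<bar>a - a\<bar>) (at a)"
    by (intro tendsto_intros)
  have "norm ((G t - G a) / (t - a)) \<le> M * \<bar>t - a\<bar>" if "t \<noteq> a" for t
  proof -
    have "\<bar>G t\<bar> \<le> (M * \<bar>t - a\<bar>) * \<bar>t - a\<bar>"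
      using assms [of t] by (simp add: power2_eq_square mult.assoc)
    then show ?thesis
      using that \<open>G a = 0\<close> by (simp add: pos_divide_le_eq)
  qed
  then have "\<forall>\<^sub>F t in at a. norm ((G t - G a) / (t - a)) \<le> M * \<bar>t - a\<bar>"
    by (simp add: eventually_at_filter)
  then have "((\<lambda>t. (G t - G a) / (t - a)) \<longlongrightarrow> 0) (at a)"
    by (rule Lim_null_comparison) (use lim in simp)
  then show ?thesis by (simp add: has_field_derivative_iff)
qed

text \<open>The polynomials \<open>[:0, 1, -1:]\<close> and \<open>[:1, -2:]\<close> are
  \<open>t * (1 - t)\<close> and its derivative. Inside the interval the product rule is brought
  over a common inverse power; at 0 and 1 the quadratic bound yields derivative 0.\<close>

lemma bump_has_derivative:
  "(bump p k has_real_derivative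
     bump (pderiv p * [:0, 1, -1:]\<^sup>2 - of_nat k * p * [:1, -2:] * [:0, 1, -1:] + p * [:1, -2:]) (k + 2) t) (at t)"
  (is "(_ has_real_derivative bump ?P _ t) _")
proof -
  consider "t < 0 \<or> t > 1" | "t = 0 \<or> t = 1" | "0 < t" "t < 1" by linarith
  then show ?thesis
  proof cases
    case 1
    have "((\<lambda>_. 0) has_real_derivative 0) (at t)" by simp
    then have "(bump p k has_real_derivative 0) (at t)"
      by (rule has_field_derivative_transform_within_open [where S = "{..<0} \<union> {1<..}"])
         (use 1 in \<open>auto simp: bump_def\<close>)
    then show ?thesis using 1 by (auto simp: bump_def)
  next
    case 2
    obtain M where M: "\<And>t. 0 < t \<Longrightarrow> t < 1 \<Longrightarrow> \<bar>bump p k t\<bar> \<le> M * (t * (1 - t))\<^sup>2"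
      using bump_bound by blast
    have "0 \<le> M * (1 / 2 * (1 - 1 / 2))\<^sup>2" using M [of "1 / 2"] by simp
    then have M0: "0 \<le> M" by (simp add: zero_le_mult_iff)
    have "\<bar>bump p k s\<bar> \<le> M * (s - t)\<^sup>2" for s
    proof (cases "0 < s \<and> s < 1")
      case True
      \<comment> \<open>\<open>s * (1 - s)\<close> is at most the distance from \<open>s\<close> to
        either end, hence the second-order zero is quadratic in \<open>s - t\<close>.\<close>
      have "s * (1 - s) \<le> s * 1" "s * (1 - s) \<le> 1 * (1 - s)"
        using True by (intro mult_left_mono mult_right_mono; simp)+
      then have "s * (1 - s) \<le> \<bar>s - t\<bar>" using 2 by auto
      then have "(s * (1 - s))\<^sup>2 \<le> \<bar>s - t\<bar>\<^sup>2"
        using True by (intro power_mono) auto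
      then have "M * (s * (1 - s))\<^sup>2 \<le> M * (s - t)\<^sup>2" using M0 by (simp add: mult_left_mono)
      then show ?thesis using M [of s] True by simp
    qed (use M0 in \<open>auto simp: bump_def\<close>)
    then have "(bump p k has_real_derivative 0) (at t)"
      by (rule quadratic_bound_has_derivative_0)
    then show ?thesis using 2 by (auto simp: bump_def)
  next
    case 3
    define q where "q = t * (1 - t)"
    define r where "r = inverse q"
    have q: "q \<noteq> 0" using 3 by (simp add: q_def)
    have "((\<lambda>t. t * (1 - t)) has_real_derivative 1 - 2 * t) (at t)"
      by (auto intro!: derivative_eq_intros)
    then have dr: "((\<lambda>t. inverse (t * (1 - t))) has_real_derivative - (r * (1 - 2 * t) * r)) (at t)"
      unfolding r_def q_def by (rule DERIV_inverse') (use q in \<open>simp add: q_def\<close>)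
    have qr: "q * r = 1" using q by (simp add: r_def)
    \<comment> \<open>For \<open>k = 0\<close> the truncated exponent \<open>k - Suc 0\<close> does
      no harm, since the factor \<open>real k\<close> vanishes.\<close>
    have kr: "real k * r ^ (k - Suc 0) * r = real k * r ^ k"
      by (cases k) (auto simp: mult.commute)
    have "((\<lambda>t. poly p t * inverse (t * (1 - t)) ^ k * exp (- inverse (t * (1 - t)))) has_real_derivative
        (poly (pderiv p) t * r ^ k
          + (real k * (- (r * (1 - 2 * t) * r) * r ^ (k - Suc 0))) * poly p t) * exp (- r)
          + (exp (- r) * - (- (r * (1 - 2 * t) * r))) * (poly p t * r ^ k)) (at t)"
      using DERIV_mult [OF DERIV_mult [OF poly_DERIV DERIV_power [OF dr]]
          DERIV_chain2 [OF DERIV_exp DERIV_minus [OF dr]], of p k]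
      by (simp only: r_def q_def)
    also have "(poly (pderiv p) t * r ^ k
          + (real k * (- (r * (1 - 2 * t) * r) * r ^ (k - Suc 0))) * poly p t) * exp (- r)
          + (exp (- r) * - (- (r * (1 - 2 * t) * r))) * (poly p t * r ^ k)
        = (poly (pderiv p) t * r ^ k - (real k * r ^ (k - Suc 0) * r) * ((1 - 2 * t) * r * poly p t)
          + (1 - 2 * t) * r * r * poly p t * r ^ k) * exp (- r)"
      by (simp add: algebra_simps)
    \<comment> \<open>Inserting powers of \<open>q * r\<close>, which equals 1, raises all three
      terms to the common factor \<open>r ^ (k + 2)\<close>.\<close>
    also have "\<dots> = (poly (pderiv p) t * (q * r)\<^sup>2 - real k * ((1 - 2 * t) * (q * r) * r * poly p t)
          + (1 - 2 * t) * r * r * poly p t) * r ^ k * exp (- r)"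
      unfolding kr qr by (simp add: algebra_simps)
    also have "\<dots> = poly ?P t * r ^ (k + 2) * exp (- r)"
      by (simp add: q_def power2_eq_square power_add algebra_simps)
    also have "\<dots> = bump ?P (k + 2) t"
      using 3 by (simp only: bump_def r_def q_def) simp
    finally have "((\<lambda>t. poly p t * inverse (t * (1 - t)) ^ k * exp (- inverse (t * (1 - t)))) has_real_derivative
        bump ?P (k + 2) t) (at t)" .
    then show ?thesis
      by (rule has_field_derivative_transform_within_open [where S = "{0<..<1}"])
         (use 3 in \<open>auto simp: bump_def\<close>)
  qed
qed

text \<open>The step is the normalised antiderivative of \<open>bump 1 0\<close>, which is
  \<open>exp (- inverse (t * (1 - t)))\<close> inside the unit interval and 0 outside, where the
  antiderivative is therefore constant.\<close>

lemma smooth_unit_step: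
  obtains F \<rho> :: "real \<Rightarrow> real"
  where "\<And>n. (deriv ^^ n) F differentiable_on UNIV"
    and "\<And>t. (F has_real_derivative \<rho> t) (at t)"
    and "continuous_on UNIV \<rho>"
    and "\<And>t. \<rho> t \<ge> 0"
    and "\<And>t. t \<le> 0 \<Longrightarrow> F t = 0" "\<And>t. t \<ge> 1 \<Longrightarrow> F t = 1"
    and "\<And>t. \<rho> t \<noteq> 0 \<Longrightarrow> t \<in> {0..1}"
proof -
  have bump_cont: "continuous_on UNIV (bump 1 0)"
    by (rule DERIV_continuous_on) (rule bump_has_derivative [THEN DERIV_subset, OF subset_UNIV])
  then have "\<And>t. isCont (bump 1 0) t" by (simp add: continuous_on_eq_continuous_at)
  then obtain H where H: "\<And>t. (H has_real_derivative bump 1 0 t) (at t)"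
    using einterval_antiderivative [of "-\<infinity>" "\<infinity>" "bump 1 0"]
    by (auto simp: has_real_derivative_iff_has_vector_derivative)
  have Hc: "continuous_on A H" for A
    using H by (meson DERIV_isCont continuous_at_imp_continuous_on)
  have H': "(H has_real_derivative 0) (at s)" if "s \<le> 0 \<or> 1 \<le> s" for s
    using H [of s] that by (auto simp: bump_def)
  have H0: "H t = H 0" if "t \<le> 0" for t
    using that DERIV_isconst_end [of t 0 H] Hc H' by (cases "t = 0") auto
  have H1: "H t = H 1" if "t \<ge> 1" for t
    using that DERIV_isconst_end [of 1 t H] Hc H' by (cases "t = 1") auto
  have "H 0 < H 1"
  proof (rule DERIV_pos_imp_increasing_open [of 0 1])
    fix t :: real assume "0 < t" "t < 1"
    then show "\<exists>y. (H has_real_derivative y) (at t) \<and> y > 0"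
      using H [of t] by (intro exI [of _ "bump 1 0 t"]) (auto simp: bump_def)
  qed (use Hc in auto)
  define c where "c = H 1 - H 0"
  have c: "c > 0" using \<open>H 0 < H 1\<close> by (simp add: c_def)
  define F where "F t = (H t - H 0) / c" for t
  define \<rho> where "\<rho> t = bump 1 0 t / c" for t
  have F: "(F has_real_derivative \<rho> t) (at t)" for t
    unfolding F_def \<rho>_def using H c by (auto intro!: derivative_eq_intros)
  \<comment> \<open>Scaled bumps are closed under differentiation, and adding \<open>F\<close>,
    whose derivative is one of them, keeps the family closed.\<close>
  let ?\<F> = "insert F {\<lambda>t. bump p k t / c | p k. True}"
  have "(deriv ^^ n) F differentiable_on UNIV" for n
  proof (rule derivative_closed_iterated_deriv_differentiable [of ?\<F>])
    fix G assume "G \<in> ?\<F>"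
    then consider "G = F" | p k where "G = (\<lambda>t. bump p k t / c)" by blast
    then show "\<exists>G'\<in>?\<F>. \<forall>t. (G has_real_derivative G' t) (at t)"
    proof cases
      case 1
      have "\<rho> \<in> ?\<F>" by (auto simp: \<rho>_def fun_eq_iff)
      with F 1 show ?thesis by (intro bexI [of _ \<rho>]) auto
    next
      case 2
      obtain p' k' where "\<And>t. (G has_real_derivative bump p' k' t / c) (at t)"
        unfolding 2 using DERIV_cdivide [OF bump_has_derivative [of p k], of c] by blast
      then show ?thesis by (intro bexI [of _ "\<lambda>t. bump p' k' t / c"]) auto
    qed
  qed simp
  moreover have "continuous_on UNIV \<rho>"
    unfolding \<rho>_def using c by (intro continuous_intros bump_cont) auto
  moreover have "\<rho> t \<ge> 0" for t using c by (simp add: \<rho>_def bump_def)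
  moreover have "F t = 0" if "t \<le> 0" for t using H0 [OF that] by (simp add: F_def)
  moreover have "F t = 1" if "t \<ge> 1" for t using H1 [OF that] c by (simp add: F_def c_def)
  moreover have "t \<in> {0..1}" if "\<rho> t \<noteq> 0" for t
    using that by (auto simp: \<rho>_def bump_def split: if_splits)
  ultimately show thesis using F that by blast
qed

section \<open>Sobolev functions on a grid\<close>

text \<open>The kernel is a probability density living where \<open>u\<close> differs from
  \<open>u x\<close> by at most \<open>\<eta>\<close>; continuity and bounded support give
  integrability.\<close>

lemma kernel_average_close:
  fixes u k :: "real \<Rightarrow> real"
  assumes u: "integrable lborel u" "continuous_on UNIV u"
    and k: "continuous_on UNIV k" "\<And>t. 0 \<le> k t" "\<And>t. k t \<noteq> 0 \<Longrightarrow> t \<in> {x..y}"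
    and one: "(LINT t|lborel. k t) = 1"
    and close: "\<And>t. t \<in> {x..y} \<Longrightarrow> \<bar>u t - u x\<bar> \<le> \<eta>"
  shows "integrable lborel (\<lambda>t. u t * k t)"
    and "\<bar>(LINT t|lborel. u t * k t) - u x\<bar> \<le> \<eta>"
proof -
  have int: "integrable lborel (\<lambda>t. w t * k t)" if w: "continuous_on UNIV w" for w :: "real \<Rightarrow> real"
  proof -
    have "set_integrable lborel {x..y} (\<lambda>t. w t * k t)"
      by (intro borel_integrable_atLeastAtMost' continuous_intros
          continuous_on_subset [OF w] continuous_on_subset [OF k(1)]) auto
    then have "integrable lborel (\<lambda>t. indicator {x..y} t *\<^sub>R (w t * k t))"
      by (simp add: set_integrable_def)
    also have "(\<lambda>t. indicator {x..y} t *\<^sub>R (w t * k t)) = (\<lambda>t. w t * k t)"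
      using k(3) by (fastforce simp: indicator_def fun_eq_iff)
    finally show ?thesis .
  qed
  show uk: "integrable lborel (\<lambda>t. u t * k t)" by (intro int u)
  have kint: "integrable lborel k" using int [of "\<lambda>_. 1"] by simp
  have "(LINT t|lborel. u t * k t) - u x = (LINT t|lborel. u t * k t - u x * k t)"
    using uk kint one by simp
  also have "\<bar>\<dots>\<bar> \<le> (LINT t|lborel. \<eta> * k t)"
    unfolding real_norm_def [symmetric]
  proof (rule Bochner_Integration.integral_norm_bound_integral)
    fix t
    have "\<bar>u t - u x\<bar> * k t \<le> \<eta> * k t"
    proof (cases "k t = 0")
      case False
      then show ?thesis using close k by (intro mult_right_mono) auto
    qed simp
    then show "norm (u t * k t - u x * k t) \<le> \<eta> * k t"
      using k(2) [of t] by (simp add: abs_mult flip: left_diff_distrib)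
  qed (use uk kint in auto)
  also have "\<dots> = \<eta>" using one by simp
  finally show "\<bar>(LINT t|lborel. u t * k t) - u x\<bar> \<le> \<eta>" .
qed

text \<open>Testing against a smooth approximation of the indicator of \<open>{x..y}\<close>; the slack \<open>h\<close>
  in the domain of integration makes a limit passage unnecessary.\<close>
lemma weak_derivative_increment_bound:
  fixes u g :: "real \<Rightarrow> real"
  assumes u: "integrable lborel u" "continuous_on UNIV u"
    and g: "integrable lborel g" and wd: "weak_derivative u g"
    and "h > 0" "x \<le> y"
  shows "\<bar>u x - u y\<bar> \<le> (LINT t:{x..y + h}|lborel. \<bar>g t\<bar>)"
proof (rule field_le_epsilon)
  fix e :: real assume "e > 0"
  obtain F \<rho> :: "real \<Rightarrow> real"
    where smooth: "\<And>n. (deriv ^^ n) F differentiable_on UNIV"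
      and F: "\<And>t. (F has_real_derivative \<rho> t) (at t)"
      and \<rho>: "continuous_on UNIV \<rho>" "\<And>t. \<rho> t \<ge> 0" "\<And>t. \<rho> t \<noteq> 0 \<Longrightarrow> t \<in> {0..1}"
      and F0: "\<And>t. t \<le> 0 \<Longrightarrow> F t = 0" and F1: "\<And>t. t \<ge> 1 \<Longrightarrow> F t = 1"
    by (rule smooth_unit_step) blast
  have mono: "F s \<le> F t" if "s \<le> t" for s t
    by (rule DERIV_nonneg_imp_nondecreasing [OF that]) (use F \<rho>(2) in blast)
  have range: "0 \<le> F t" "F t \<le> 1" for t
    using mono [of "min t 0" t] mono [of t "max t 1"] F0 [of "min t 0"] F1 [of "max t 1"] by auto
  have "\<exists>d>0. \<forall>t. \<bar>t - z\<bar> \<le> d \<longrightarrow> \<bar>u t - u z\<bar> \<le> e / 2" for z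
  proof -
    obtain d where "d > 0" "\<And>t. dist t z < d \<Longrightarrow> dist (u t) (u z) < e / 2"
      using u(2) \<open>e > 0\<close> unfolding continuous_on_iff by (metis UNIV_I half_gt_zero)
    then have "0 < d / 2 \<and> (\<forall>t. \<bar>t - z\<bar> \<le> d / 2 \<longrightarrow> \<bar>u t - u z\<bar> \<le> e / 2)"
      by (force simp: dist_real_def intro: less_imp_le)
    then show ?thesis by blast
  qed
  then obtain dx dy where d: "dx > 0" "dy > 0"
      "\<And>t. \<bar>t - x\<bar> \<le> dx \<Longrightarrow> \<bar>u t - u x\<bar> \<le> e / 2"
      "\<And>t. \<bar>t - y\<bar> \<le> dy \<Longrightarrow> \<bar>u t - u y\<bar> \<le> e / 2"
    by blast
  \<comment> \<open>Small enough that the descent after \<open>y\<close> ends before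
    \<open>y + h\<close> and that each endpoint average costs at most \<open>e / 2\<close>.\<close>
  define \<epsilon> where "\<epsilon> = min h (min dx dy)"
  have \<epsilon>: "\<epsilon> > 0" "\<epsilon> \<le> h" "\<epsilon> \<le> dx" "\<epsilon> \<le> dy" using d \<open>h > 0\<close> by (auto simp: \<epsilon>_def)
  define k where "k z = (\<lambda>t. \<rho> ((t - z) / \<epsilon>) / \<epsilon>)" for z
  have k_cont: "continuous_on A (k z)" for A z
    unfolding k_def using \<epsilon>
    by (intro continuous_intros continuous_on_compose2 [OF \<rho>(1)]) auto
  have k_nonneg: "0 \<le> k z t" for z t using \<rho>(2) \<epsilon> by (simp add: k_def)
  have k_supp: "t \<in> {z..z + \<epsilon>}" if "k z t \<noteq> 0" for z t
    using \<rho>(3) [of "(t - z) / \<epsilon>"] that \<epsilon> by (auto simp: k_def field_simps)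
  have scale: "((\<lambda>t. (t - z) / \<epsilon>) has_real_derivative 1 / \<epsilon>) (at t)" for z t
    using \<epsilon> by (auto intro!: derivative_eq_intros)
  have k_deriv: "((\<lambda>t. F ((t - z) / \<epsilon>)) has_real_derivative k z t) (at t)" for z t
    using DERIV_chain2 [OF F scale] by (simp add: k_def)
  have k_one: "(LINT t|lborel. k z t) = 1" for z
  proof -
    have "(LINT t|lborel. k z t * indicator {z..z + \<epsilon>} t) = F ((z + \<epsilon> - z) / \<epsilon>) - F ((z - z) / \<epsilon>)"
      using \<epsilon> k_cont [of UNIV]
      by (intro integral_FTC_Icc_real k_deriv) (auto simp: continuous_on_eq_continuous_at)
    also have "(\<lambda>t. k z t * indicator {z..z + \<epsilon>} t) = k z"
      using k_supp by (fastforce simp: indicator_def fun_eq_iff)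
    finally show ?thesis using \<epsilon> F0 F1 by simp
  qed
  \<comment> \<open>This function climbs just to the right of \<open>x\<close> and descends just to
    the right of \<open>y\<close>. Its derivative is the difference of two approximate identities,
    so testing \<open>u\<close> against it nearly gives \<open>u x - u y\<close>.\<close>
  define \<phi> where "\<phi> = (\<lambda>t. F ((t - x) / \<epsilon>) - F ((t - y) / \<epsilon>))"
  have \<phi>_deriv: "deriv \<phi> t = k x t - k y t" for t
    unfolding \<phi>_def by (intro DERIV_imp_deriv DERIV_diff k_deriv)
  have \<phi>_supp: "t \<in> {x..y + \<epsilon>}" if "\<phi> t \<noteq> 0" for t
  proof (rule ccontr)
    assume "t \<notin> {x..y + \<epsilon>}"
    then consider "t < x" | "t > y + \<epsilon>" by fastforce
    then have "\<phi> t = 0"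
    proof cases
      case 1
      then show ?thesis
        using F0 [of "(t - x) / \<epsilon>"] F0 [of "(t - y) / \<epsilon>"] \<epsilon> \<open>x \<le> y\<close> by (simp add: \<phi>_def divide_le_0_iff)
    next
      case 2
      then show ?thesis
        using F1 [of "(t - x) / \<epsilon>"] F1 [of "(t - y) / \<epsilon>"] \<epsilon> \<open>x \<le> y\<close> by (simp add: \<phi>_def pos_le_divide_eq)
    qed
    with that show False by simp
  qed
  have \<phi>_range: "\<bar>\<phi> t\<bar> \<le> 1" for t
    using range [of "(t - x) / \<epsilon>"] range [of "(t - y) / \<epsilon>"] by (simp add: \<phi>_def)
  have \<phi>_cont: "continuous_on UNIV \<phi>"
    unfolding \<phi>_def by (rule DERIV_continuous_on, rule DERIV_diff; rule k_deriv)
  have "test_function \<phi>"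
    unfolding test_function_def
  proof (intro conjI allI)
    fix n
    have "(\<lambda>t. (deriv ^^ n) F ((t - z) / \<epsilon>)) differentiable_on UNIV" for z
    proof -
      have "((deriv ^^ n) F has_real_derivative deriv ((deriv ^^ n) F) s) (at s)" for s
        using smooth [of n] by (auto simp: differentiable_on_def DERIV_deriv_iff_real_differentiable)
      from DERIV_chain2 [OF this scale] show ?thesis
        unfolding differentiable_on_def real_differentiable_def by blast
    qed
    then show "(deriv ^^ n) \<phi> differentiable_on UNIV"
      unfolding \<phi>_def using \<epsilon>
      by (subst iterated_deriv_affine_diff [OF smooth])
        (auto simp: differentiable_on_def intro!: differentiable_divide differentiable_diff)
  next
    have "closure {t. \<phi> t \<noteq> 0} \<subseteq> {x..y + \<epsilon>}"
      by (rule closure_minimal) (use \<phi>_supp in auto)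
    then show "compact (closure {t. \<phi> t \<noteq> 0})"
      by (meson bounded_closed_interval bounded_subset closed_closure compact_eq_bounded_closed)
  qed
  with wd have eq: "(LINT t|lborel. u t * deriv \<phi> t) = - (LINT t|lborel. g t * \<phi> t)"
    by (simp add: weak_derivative_def)
  have avg: "integrable lborel (\<lambda>t. u t * k z t)" "\<bar>(LINT t|lborel. u t * k z t) - u z\<bar> \<le> e / 2"
    if "z = x \<or> z = y" for z
  proof -
    have close: "\<bar>u t - u z\<bar> \<le> e / 2" if "t \<in> {z..z + \<epsilon>}" for t
      using \<open>z = x \<or> z = y\<close> that \<epsilon> d(3) [of t] d(4) [of t] by auto
    show "integrable lborel (\<lambda>t. u t * k z t)" "\<bar>(LINT t|lborel. u t * k z t) - u z\<bar> \<le> e / 2"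
      using kernel_average_close [of u "k z" z "z + \<epsilon>" "e / 2",
          OF u k_cont k_nonneg k_supp k_one close] by blast+
  qed
  \<comment> \<open>The weak derivative identity now compares the two averages with an integral of
    \<open>g\<close> against \<open>\<phi>\<close>, where \<open>\<phi>\<close> is at most 1 in
    modulus and vanishes off \<open>{x..y + \<epsilon>}\<close>.\<close>
  have "(LINT t|lborel. u t * deriv \<phi> t) = (LINT t|lborel. u t * k x t) - (LINT t|lborel. u t * k y t)"
    using avg(1) by (simp add: \<phi>_deriv right_diff_distrib)
  then have "\<bar>u x - u y\<bar> \<le> \<bar>LINT t|lborel. g t * \<phi> t\<bar> + e"
    using avg(2) [of x] avg(2) [of y] eq by linarith
  also have "\<bar>LINT t|lborel. g t * \<phi> t\<bar> \<le> (LINT t:{x..y + h}|lborel. \<bar>g t\<bar>)"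
    unfolding set_lebesgue_integral_def real_norm_def [symmetric]
  proof (rule Bochner_Integration.integral_norm_bound_integral)
    have [measurable]: "\<phi> \<in> borel_measurable borel"
      using \<phi>_cont by (rule borel_measurable_continuous_onI)
    show "integrable lborel (\<lambda>t. g t * \<phi> t)"
      by (rule Bochner_Integration.integrable_bound [OF g])
        (use g \<phi>_range in \<open>auto simp: abs_mult mult_left_le\<close>)
    show "integrable lborel (\<lambda>t. indicator {x..y + h} t *\<^sub>R norm (g t))"
      using g by (intro integrable_mult_indicator) auto
    fix t
    show "norm (g t * \<phi> t) \<le> indicator {x..y + h} t *\<^sub>R norm (g t)"
      using \<phi>_supp [of t] \<phi>_range [of t] \<epsilon>
      by (cases "\<phi> t = 0") (auto simp: abs_mult mult_left_le indicator_def)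
  qed
  finally show "\<bar>u x - u y\<bar> \<le> (LINT t:{x..y + h}|lborel. \<bar>g t\<bar>) + e" by simp
qed

text \<open>The intervals have length \<open>2 * h\<close> on a mesh of size \<open>h\<close>, so
  they overlap at most three times (exactly three at grid points). All partial sums stay below three
  times the full integral.\<close>

lemma summable_grid_integrals:
  fixes u :: "real \<Rightarrow> real"
  assumes u: "integrable lborel u" "\<And>t. 0 \<le> u t" and "h > 0"
  shows "(\<lambda>i::int. LINT t:{i * h..i * h + 2 * h}|lborel. u t) summable_on UNIV"
proof (rule nonneg_bdd_above_summable_on)
  let ?I = "\<lambda>i::int. {i * h..i * h + 2 * h}"
  have ui: "integrable lborel (\<lambda>t. indicator (?I i) t *\<^sub>R u t)" for i
    using u by (intro integrable_mult_indicator) auto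
  show "0 \<le> (LINT t:?I i|lborel. u t)" for i
    unfolding set_lebesgue_integral_def using u by (intro Bochner_Integration.integral_nonneg) auto
  show "bdd_above (sum (\<lambda>i. LINT t:?I i|lborel. u t) ` {J. J \<subseteq> UNIV \<and> finite J})"
  proof (rule bdd_aboveI2)
    fix J :: "int set" assume "J \<in> {J. J \<subseteq> UNIV \<and> finite J}"
    then have J: "finite J" by simp
    have "(\<Sum>i\<in>J. LINT t:?I i|lborel. u t) = (LINT t|lborel. (\<Sum>i\<in>J. indicator (?I i) t *\<^sub>R u t))"
      unfolding set_lebesgue_integral_def using ui by (simp add: Bochner_Integration.integral_sum)
    also have "\<dots> \<le> (LINT t|lborel. 3 * u t)"
    proof (rule Bochner_Integration.integral_mono)
      show "integrable lborel (\<lambda>t. \<Sum>i\<in>J. indicator (?I i) t *\<^sub>R u t)"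
        using ui by (rule Bochner_Integration.integrable_sum)
      fix t
      have "{i\<in>J. t \<in> ?I i} \<subseteq> {\<lfloor>t / h\<rfloor> - 2..\<lfloor>t / h\<rfloor>}"
      proof
        fix i assume "i \<in> {i\<in>J. t \<in> ?I i}"
        then have "of_int i \<le> t / h" "t / h \<le> of_int (i + 2)"
          using \<open>h > 0\<close> by (auto simp: field_simps)
        then show "i \<in> {\<lfloor>t / h\<rfloor> - 2..\<lfloor>t / h\<rfloor>}" by (simp add: le_floor_iff) linarith
      qed
      then have "card {i\<in>J. t \<in> ?I i} \<le> card {\<lfloor>t / h\<rfloor> - 2..\<lfloor>t / h\<rfloor>}"
        by (intro card_mono) auto
      then have "real (card {i\<in>J. t \<in> ?I i}) \<le> 3" by simp
      moreover have "(\<Sum>i\<in>J. indicator (?I i) t :: real) = real (card {i\<in>J. t \<in> ?I i})"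
        using J by (simp add: indicator_def sum.If_cases Int_def)
      ultimately have "(\<Sum>i\<in>J. indicator (?I i) t) * u t \<le> 3 * u t"
        using u(2) [of t] by (intro mult_right_mono) auto
      then show "(\<Sum>i\<in>J. indicator (?I i) t *\<^sub>R u t) \<le> 3 * u t"
        by (simp add: sum_distrib_right)
    qed (use u in simp)
    finally show "(\<Sum>i\<in>J. LINT t:?I i|lborel. u t) \<le> (LINT t|lborel. 3 * u t)" .
  qed
qed

lemma sobolev_W11_grid_summable:
  fixes u :: "real \<Rightarrow> real"
  assumes W: "sobolev_W11 u" and cont: "continuous_on UNIV u" and h: "h > 0"
  shows "(\<lambda>i. \<bar>grid_restriction h u i\<bar>) summable_on UNIV"
proof -
  obtain g where u: "integrable lborel u" and g: "integrable lborel g" and wd: "weak_derivative u g"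
    using W by (auto simp: sobolev_W11_def)
  \<comment> \<open>The first summand will produce the mean of \<open>u\<close> in modulus, the
    second the variation of \<open>u\<close>.\<close>
  define w where "w = (\<lambda>t. \<bar>u t\<bar> / h + \<bar>g t\<bar>)"
  have w: "integrable lborel w" "\<And>t. 0 \<le> w t"
    unfolding w_def using u g h
    by (auto intro!: Bochner_Integration.integrable_add integrable_divide integrable_abs)
  have sub: "set_integrable lborel {a..b} v" if "integrable lborel v" for a b :: real and v :: "real \<Rightarrow> real"
    unfolding set_integrable_def using that by (intro integrable_mult_indicator) auto
  have mono: "(LINT t:{a..b}|lborel. v t) \<le> (LINT t:{c..d}|lborel. v t)"
    if "integrable lborel v" "\<And>t. 0 \<le> v t" "c \<le> a" "b \<le> d" for a b c d and v :: "real \<Rightarrow> real"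
    unfolding set_lebesgue_integral_def
    by (intro Bochner_Integration.integral_mono integrable_mult_indicator)
      (use that in \<open>auto simp: indicator_def\<close>)
  have bound: "\<bar>u x\<bar> \<le> (LINT t:{x..x + 2 * h}|lborel. w t)" for x
  proof -
    let ?g = "LINT t:{x..x + 2 * h}|lborel. \<bar>g t\<bar>"
    \<comment> \<open>The pointwise increment bound is averaged over \<open>t\<close> in
      \<open>{x..x + h}\<close>; the slack \<open>h\<close> in that bound is why \<open>?g\<close>
      reaches to \<open>x + 2 * h\<close>.\<close>
    have "(LINT t:{x..x + h}|lborel. \<bar>u x\<bar> - ?g) \<le> (LINT t:{x..x + h}|lborel. \<bar>u t\<bar>)"
    proof (rule set_integral_mono)
      fix t assume t: "t \<in> {x..x + h}"
      have "\<bar>u x - u t\<bar> \<le> (LINT s:{x..t + h}|lborel. \<bar>g s\<bar>)"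
        using weak_derivative_increment_bound [OF u cont g wd h] t by simp
      also have "\<dots> \<le> ?g"
        using t g by (intro mono) auto
      finally show "\<bar>u x\<bar> - ?g \<le> \<bar>u t\<bar>" by simp
    next
      show "set_integrable lborel {x..x + h} (\<lambda>t. \<bar>u x\<bar> - ?g)"
        by (intro borel_integrable_atLeastAtMost' continuous_intros)
      show "set_integrable lborel {x..x + h} (\<lambda>t. \<bar>u t\<bar>)"
        using u by (intro sub integrable_abs)
    qed
    also have "(LINT t:{x..x + h}|lborel. \<bar>u x\<bar> - ?g) = h * (\<bar>u x\<bar> - ?g)"
      using h by (simp add: set_lebesgue_integral_def)
    also have "(LINT t:{x..x + h}|lborel. \<bar>u t\<bar>) \<le> (LINT t:{x..x + 2 * h}|lborel. \<bar>u t\<bar>)"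
      using u h by (intro mono) auto
    finally have "\<bar>u x\<bar> \<le> (LINT t:{x..x + 2 * h}|lborel. \<bar>u t\<bar>) / h + ?g"
      using h by (simp add: field_simps)
    also have "\<dots> = (LINT t:{x..x + 2 * h}|lborel. w t)"
      using u g h unfolding w_def by (subst set_integral_add) (auto intro!: sub)
    finally show ?thesis .
  qed
  have "(\<lambda>i. LINT t:{of_int i * h..of_int i * h + 2 * h}|lborel. w t) summable_on UNIV"
    by (rule summable_grid_integrals [OF w h])
  then show ?thesis
    by (rule summable_on_comparison_test) (use bound in \<open>auto simp: grid_restriction_def\<close>)
qed

section \<open>Discrete convolutions\<close>

text \<open>The difference is the sum over the complement of \<open>J\<close>, where
  \<open>w\<close> is small. The global bound \<open>B\<close> secures convergence and does not
  enter the estimate.\<close>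

lemma infsum_convolution_truncation_bound:
  fixes A w :: "int \<Rightarrow> real"
  assumes A: "(\<lambda>i. \<bar>A i\<bar>) summable_on UNIV" and "finite J"
    and B: "\<And>j. \<bar>w j\<bar> \<le> B" and small: "\<And>j. j \<notin> J \<Longrightarrow> \<bar>w j\<bar> \<le> \<epsilon>" and "0 \<le> \<epsilon>"
  shows "\<bar>(\<Sum>\<^sub>\<infinity>j. A (i - j) * w j) - (\<Sum>j\<in>J. A (i - j) * w j)\<bar> \<le> (\<Sum>\<^sub>\<infinity>j. \<bar>A j\<bar>) * \<epsilon>"
proof -
  have bij: "bij_betw (\<lambda>j. i - j) UNIV (UNIV :: int set)"
    by (rule bij_betwI [where g = "\<lambda>j. i - j"]) auto
  have A': "(\<lambda>j. \<bar>A (i - j)\<bar>) summable_on UNIV" "(\<Sum>\<^sub>\<infinity>j. \<bar>A (i - j)\<bar>) = (\<Sum>\<^sub>\<infinity>j. \<bar>A j\<bar>)"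
    using A summable_on_reindex_bij_betw [OF bij, of "\<lambda>j. \<bar>A j\<bar>"]
      infsum_reindex_bij_betw [OF bij, of "\<lambda>j. \<bar>A j\<bar>"] by auto
  have "(\<lambda>j. norm (A (i - j) * w j)) summable_on UNIV"
  proof (rule summable_on_comparison_test)
    show "(\<lambda>j. \<bar>A (i - j)\<bar> * B) summable_on UNIV"
      using A'(1) by (rule summable_on_cmult_left)
  qed (use B in \<open>auto simp: abs_mult intro: mult_left_mono\<close>)
  from summable_on_subset_banach [OF abs_summable_summable [OF this]]
  have Aw: "(\<lambda>j. A (i - j) * w j) summable_on S" for S by simp
  have "(\<Sum>\<^sub>\<infinity>j\<in>UNIV. A (i - j) * w j) = (\<Sum>\<^sub>\<infinity>j\<in>J \<union> - J. A (i - j) * w j)" by simp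
  also have "\<dots> = (\<Sum>\<^sub>\<infinity>j\<in>J. A (i - j) * w j) + (\<Sum>\<^sub>\<infinity>j\<in>- J. A (i - j) * w j)"
    by (intro infsum_Un_disjoint Aw) auto
  finally have "\<bar>(\<Sum>\<^sub>\<infinity>j. A (i - j) * w j) - (\<Sum>j\<in>J. A (i - j) * w j)\<bar> = norm (\<Sum>\<^sub>\<infinity>j\<in>- J. A (i - j) * w j)"
    using \<open>finite J\<close> by simp
  also have "\<dots> \<le> (\<Sum>\<^sub>\<infinity>j\<in>- J. \<bar>A (i - j)\<bar> * \<epsilon>)"
  proof (rule norm_infsum_le)
    show "((\<lambda>j. A (i - j) * w j) has_sum (\<Sum>\<^sub>\<infinity>j\<in>- J. A (i - j) * w j)) (- J)"
      using Aw by (rule has_sum_infsum)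
    show "((\<lambda>j. \<bar>A (i - j)\<bar> * \<epsilon>) has_sum (\<Sum>\<^sub>\<infinity>j\<in>- J. \<bar>A (i - j)\<bar> * \<epsilon>)) (- J)"
      by (intro has_sum_infsum summable_on_cmult_left summable_on_subset_banach [OF A'(1)]) auto
  qed (use small in \<open>auto simp: abs_mult intro: mult_left_mono\<close>)
  also have "\<dots> \<le> (\<Sum>\<^sub>\<infinity>j\<in>UNIV. \<bar>A (i - j)\<bar> * \<epsilon>)"
    by (intro infsum_mono_neutral summable_on_cmult_left summable_on_subset_banach [OF A'(1)])
      (use \<open>0 \<le> \<epsilon>\<close> A'(1) in auto)
  also have "\<dots> = (\<Sum>\<^sub>\<infinity>j. \<bar>A j\<bar>) * \<epsilon>"
    using A' by (simp add: infsum_cmult_left)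
  finally show ?thesis .
qed

text \<open>Young's inequality for an absolutely summable kernel and a bounded sequence. The full
  mass of \<open>A\<close> appears instead of a partial one, which makes the constants uniform in
  \<open>J\<close>.\<close>

lemma finite_convolution_bound:
  fixes A w :: "int \<Rightarrow> real"
  assumes A: "(\<lambda>i. \<bar>A i\<bar>) summable_on UNIV" and "finite J"
    and w: "\<And>j. j \<in> J \<Longrightarrow> \<bar>w j\<bar> \<le> B" and "0 \<le> B"
  shows "\<bar>\<Sum>j\<in>J. A (i - j) * w j\<bar> \<le> (\<Sum>\<^sub>\<infinity>j. \<bar>A j\<bar>) * B"
proof -
  have "\<bar>\<Sum>j\<in>J. A (i - j) * w j\<bar> \<le> (\<Sum>j\<in>J. \<bar>A (i - j)\<bar> * B)"
    by (rule sum_norm_le [where 'a = real, simplified real_norm_def])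
      (use w in \<open>auto simp: abs_mult intro: mult_left_mono\<close>)
  also have "\<dots> = (\<Sum>j\<in>(\<lambda>j. i - j) ` J. \<bar>A j\<bar>) * B"
    by (subst sum.reindex) (auto simp: inj_on_def sum_distrib_right)
  also have "\<dots> \<le> (\<Sum>\<^sub>\<infinity>j. \<bar>A j\<bar>) * B"
    using \<open>finite J\<close> \<open>0 \<le> B\<close> by (intro mult_right_mono finite_sum_le_infsum A) auto
  finally show ?thesis .
qed

text \<open>The second difference combines three shifted convergent sums, so it may be moved onto
  the kernel. This gives the lattice equation the same form as the truncated one.\<close>

lemma second_diff_discrete_conv:
  assumes b: "(\<lambda>i. \<bar>b i\<bar>) summable_on UNIV" and w: "\<And>j. \<bar>w j\<bar> \<le> B"
  shows "forward_diff h (backward_diff h (discrete_conv h b w)) i =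
    (\<Sum>\<^sub>\<infinity>j. h * forward_diff h (backward_diff h b) (i - j) * w j)"
proof -
  have conv: "((\<lambda>j. h * b (k - j) * w j) has_sum discrete_conv h b w k) UNIV" for k
  proof -
    have bij: "bij_betw (\<lambda>j. k - j) UNIV (UNIV :: int set)"
      by (rule bij_betwI [where g = "\<lambda>j. k - j"]) auto
    have "(\<lambda>j. \<bar>b (k - j)\<bar>) summable_on UNIV"
      using b summable_on_reindex_bij_betw [OF bij, of "\<lambda>j. \<bar>b j\<bar>"] by simp
    then have "(\<lambda>j. \<bar>b (k - j)\<bar> * (\<bar>h\<bar> * B)) summable_on UNIV"
      by (rule summable_on_cmult_left)
    then have "(\<lambda>j. norm (h * b (k - j) * w j)) summable_on UNIV"
    proof (rule summable_on_comparison_test)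
      fix j
      have "\<bar>b (k - j)\<bar> * \<bar>h\<bar> * \<bar>w j\<bar> \<le> \<bar>b (k - j)\<bar> * \<bar>h\<bar> * B"
        using w by (intro mult_left_mono) auto
      then show "norm (h * b (k - j) * w j) \<le> \<bar>b (k - j)\<bar> * (\<bar>h\<bar> * B)"
        by (simp add: abs_mult ac_simps)
    qed auto
    from has_sum_infsum [OF abs_summable_summable [OF this]] show ?thesis
      by (simp add: discrete_conv_def)
  qed
  let ?c = "discrete_conv h b w"
  have "((\<lambda>j. (h * b (i + 1 - j) * w j + h * b (i - j) * w j * (- 2) + h * b (i - 1 - j) * w j) * (1 / h\<^sup>2))
      has_sum (?c (i + 1) + ?c i * (- 2) + ?c (i - 1)) * (1 / h\<^sup>2)) UNIV"
    by (intro has_sum_cmult_left has_sum_add conv)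
  also have "(\<lambda>j. (h * b (i + 1 - j) * w j + h * b (i - j) * w j * (- 2) + h * b (i - 1 - j) * w j) * (1 / h\<^sup>2)) =
      (\<lambda>j. h * forward_diff h (backward_diff h b) (i - j) * w j)"
    \<comment> \<open>For \<open>h = 0\<close> both sides are 0, because division by zero yields
      zero.\<close>
    by (cases "h = 0")
      (auto simp: fun_eq_iff forward_diff_def backward_diff_def power2_eq_square field_simps)
  also have "(?c (i + 1) + ?c i * (- 2) + ?c (i - 1)) * (1 / h\<^sup>2) =
      forward_diff h (backward_diff h ?c) i"
    by (cases "h = 0")
      (auto simp: forward_diff_def backward_diff_def power2_eq_square field_simps)
  finally show ?thesis by (simp add: infsumI)
qed

lemma second_diff_summable:
  fixes b :: "int \<Rightarrow> real"
  assumes b: "(\<lambda>i. \<bar>b i\<bar>) summable_on UNIV"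
  shows "(\<lambda>i. \<bar>h * forward_diff h (backward_diff h b) i\<bar>) summable_on UNIV"
proof -
  have shift: "(\<lambda>i. \<bar>b (i + k)\<bar>) summable_on UNIV" for k
  proof -
    have "bij_betw (\<lambda>i. i + k) UNIV (UNIV :: int set)"
      by (rule bij_betwI [where g = "\<lambda>i. i - k"]) auto
    from summable_on_reindex_bij_betw [OF this, of "\<lambda>j. \<bar>b j\<bar>"] b show ?thesis by simp
  qed
  \<comment> \<open>Writing \<open>i + 0\<close> and \<open>i + -1\<close> brings every term into
    the form of \<open>shift\<close>.\<close>
  have "(\<lambda>i. (\<bar>b (i + 1)\<bar> + \<bar>b (i + 0)\<bar> + (\<bar>b (i + 0)\<bar> + \<bar>b (i + -1)\<bar>)) * \<bar>1 / h\<bar>) summable_on UNIV"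
    by (intro summable_on_cmult_left summable_on_add shift)
  then show ?thesis
  proof (rule summable_on_comparison_test)
    fix i
    have "h * forward_diff h (backward_diff h b) i = (b (i + 1) - b i - (b i - b (i - 1))) * (1 / h)"
      by (cases "h = 0") (auto simp: forward_diff_def backward_diff_def field_simps)
    then have "\<bar>h * forward_diff h (backward_diff h b) i\<bar> = \<bar>b (i + 1) - b i - (b i - b (i - 1))\<bar> * \<bar>1 / h\<bar>"
      by (simp only: abs_mult)
    also have "\<dots> \<le> (\<bar>b (i + 1)\<bar> + \<bar>b (i + 0)\<bar> + (\<bar>b (i + 0)\<bar> + \<bar>b (i + -1)\<bar>)) * \<bar>1 / h\<bar>"
      by (intro mult_right_mono) auto
    finally show "\<bar>h * forward_diff h (backward_diff h b) i\<bar> \<le> \<dots>" .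
  qed auto
qed

section \<open>The truncated system\<close>

text \<open>Evaluation at a point turns derivatives in the supremum norm into derivatives of single
  components.\<close>

lemma bounded_linear_apply_bcontfun:
  "bounded_linear (\<lambda>u :: 'a::topological_space \<Rightarrow>\<^sub>C 'b::real_normed_vector. apply_bcontfun u i)"
  by (rule bounded_linear_intro [where K = 1]) (auto simp: norm_bounded)

instance bcontfun :: (metric_space, banach) banach ..

text \<open>The phase space is the Banach space of bounded continuous functions on the line, in which
  a finite sequence sits as its piecewise linear interpolation.\<close>
lemma truncated_system_solution_exists:
  fixes g :: "real \<Rightarrow> real"
  assumes g: "L-lipschitz_on UNIV g" and T: "0 \<le> T"
  shows "\<exists>w w'. solves_truncated_system \<beta> g h T N a b w w'"
proof -
  define J where "J = {- int N..int N}"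
  define A where "A = (\<lambda>i. h * forward_diff h (backward_diff h (grid_restriction h \<beta>)) i)"
  have L: "0 \<le> L" using g lipschitz_on_nonneg by blast
  \<comment> \<open>The tent function is 1 at 0 and 0 at every other integer, so interpolation with
    its translates reproduces the components.\<close>
  define hat where "hat x = max 0 (1 - \<bar>x\<bar>)" for x :: real
  have hat: "\<bar>hat x\<bar> \<le> 1" for x by (auto simp: hat_def)
  have hat_int: "hat (of_int j - of_int i) = (if i = j then 1 else 0)" for i j
    by (auto simp: hat_def)
  have hat_sum: "\<bar>\<Sum>i\<in>J. hat (x - of_int i) * c i\<bar> \<le> (\<Sum>i\<in>J. \<bar>c i\<bar>)" for x c
  proof (rule order_trans [OF sum_abs sum_mono])
    show "\<bar>hat (x - of_int i) * c i\<bar> \<le> \<bar>c i\<bar>" for i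
      using mult_right_mono [OF hat abs_ge_zero] by (simp add: abs_mult)
  qed
  define embed where "embed c = Bcontfun (\<lambda>x. \<Sum>i\<in>J. hat (x - of_int i) * c i)" for c
  have "(\<lambda>x. \<Sum>i\<in>J. hat (x - of_int i) * c i) \<in> bcontfun" for c
  proof (rule bcontfun_normI)
    show "continuous_on UNIV (\<lambda>x. \<Sum>i\<in>J. hat (x - of_int i) * c i)"
      unfolding hat_def by (intro continuous_intros)
  qed (use hat_sum in simp)
  then have embed: "apply_bcontfun (embed c) x = (\<Sum>i\<in>J. hat (x - of_int i) * c i)" for c x
    unfolding embed_def by (simp add: Bcontfun_inverse)
  have embed_int: "apply_bcontfun (embed c) (of_int j) = c j" if "j \<in> J" for c j
    using that unfolding embed hat_int by (simp add: J_def if_distrib [of "\<lambda>x. x * _"] cong: if_cong)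
  define acc where "acc p i = (\<Sum>j\<in>J. A (i - j) * g (apply_bcontfun p (of_int j)))"
    for p :: "real \<Rightarrow>\<^sub>C real" and i
  \<comment> \<open>This constant may grow with \<open>N\<close>. Only existence is drawn from it;
    uniform bounds come from \<open>truncated_systems_close\<close>.\<close>
  define K where "K = (\<Sum>i\<in>J. \<Sum>j\<in>J. \<bar>A (i - j)\<bar> * L)"
  have K: "0 \<le> K" unfolding K_def using L by (auto intro!: sum_nonneg)
  have acc_dist: "\<bar>acc p i - acc q i\<bar> \<le> (\<Sum>j\<in>J. \<bar>A (i - j)\<bar> * L) * dist p q" for p q i
  proof -
    let ?d = "\<lambda>j. g (apply_bcontfun p (of_int j)) - g (apply_bcontfun q (of_int j))"
    have "\<bar>acc p i - acc q i\<bar> = \<bar>\<Sum>j\<in>J. A (i - j) * ?d j\<bar>"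
      by (simp add: acc_def right_diff_distrib sum_subtractf)
    also have "\<dots> \<le> (\<Sum>j\<in>J. \<bar>A (i - j)\<bar> * L * dist p q)"
    proof (rule order_trans [OF sum_abs sum_mono])
      fix j
      have "\<bar>?d j\<bar> \<le> L * dist (apply_bcontfun p (of_int j)) (apply_bcontfun q (of_int j))"
        using lipschitz_onD [OF g] by (simp add: dist_real_def)
      also have "\<dots> \<le> L * dist p q" using L by (intro mult_left_mono dist_bounded)
      finally show "\<bar>A (i - j) * ?d j\<bar> \<le> \<bar>A (i - j)\<bar> * L * dist p q"
        by (simp add: abs_mult mult_left_mono mult.assoc)
    qed
    finally show ?thesis by (simp add: sum_distrib_right)
  qed
  have acc: "dist (embed (acc p)) (embed (acc q)) \<le> K * dist p q" for p q
  proof (rule dist_bound)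
    fix x
    have "dist (apply_bcontfun (embed (acc p)) x) (apply_bcontfun (embed (acc q)) x)
        = \<bar>\<Sum>i\<in>J. hat (x - of_int i) * (acc p i - acc q i)\<bar>"
      by (simp add: embed dist_real_def right_diff_distrib sum_subtractf)
    also have "\<dots> \<le> (\<Sum>i\<in>J. \<bar>acc p i - acc q i\<bar>)" by (rule hat_sum)
    also have "\<dots> \<le> (\<Sum>i\<in>J. (\<Sum>j\<in>J. \<bar>A (i - j)\<bar> * L) * dist p q)"
      by (intro sum_mono acc_dist)
    also have "\<dots> = K * dist p q" unfolding K_def by (simp add: sum_distrib_right)
    finally show "dist (apply_bcontfun (embed (acc p)) x) (apply_bcontfun (embed (acc q)) x) \<le> K * dist p q" .
  qed
  \<comment> \<open>First-order form of the system, with \<open>p\<close> the position and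
    \<open>q\<close> the velocity.\<close>
  define G where "G = (\<lambda>(p, q :: real \<Rightarrow>\<^sub>C real). (q, embed (acc p)))"
  have "(1 + K)-lipschitz_on UNIV G"
  proof (rule lipschitz_onI)
    fix x y :: "(real \<Rightarrow>\<^sub>C real) \<times> (real \<Rightarrow>\<^sub>C real)"
    obtain p q p' q' where xy: "x = (p, q)" "y = (p', q')" by (cases x, cases y)
    have "dist (q, embed (acc p)) (q', embed (acc p')) \<le> dist q q' + dist (embed (acc p)) (embed (acc p'))"
      by (simp add: dist_Pair_Pair sqrt_sum_squares_le_sum)
    also have "\<dots> \<le> dist x y + K * dist x y"
      using acc [of p p'] K dist_fst_le [of x y] dist_snd_le [of x y]
      by (intro add_mono order_trans [OF acc] mult_left_mono) (auto simp: xy)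
    finally show "dist (G x) (G y) \<le> (1 + K) * dist x y"
      by (simp add: G_def xy algebra_simps)
  qed (use K in simp)
  from global_lipschitz_ode_solution [OF this T, of "(embed a, embed b)"]
  obtain x where x0: "x 0 = (embed a, embed b)"
    and x: "\<And>t. t \<in> {0..T} \<Longrightarrow>
      (x has_vector_derivative (snd (x t), embed (acc (fst (x t))))) (at t within {0..T})"
    by (auto simp: G_def case_prod_beta)
  define w where "w t i = apply_bcontfun (fst (x t)) (of_int i)" for t i
  define w' where "w' t i = apply_bcontfun (snd (x t)) (of_int i)" for t i
  have "((\<lambda>s. w s i) has_real_derivative w' t i) (at t within {0..T})"
    "((\<lambda>s. w' s i) has_real_derivative acc (fst (x t)) i) (at t within {0..T})"
    if "t \<in> {0..T}" "i \<in> J" for t i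
    using bounded_linear.has_vector_derivative [OF bounded_linear_compose
        [OF bounded_linear_apply_bcontfun [of "of_int i"] bounded_linear_fst] x [OF that(1)]]
      bounded_linear.has_vector_derivative [OF bounded_linear_compose
        [OF bounded_linear_apply_bcontfun [of "of_int i"] bounded_linear_snd] x [OF that(1)]] that
    by (simp_all add: w_def w'_def has_real_derivative_iff_has_vector_derivative embed_int)
  then have "solves_truncated_system \<beta> g h T N a b w w'"
    unfolding solves_truncated_system_def J_def [symmetric]
    using x0 by (auto simp: w_def w'_def embed_int acc_def A_def)
  then show ?thesis by blast
qed

text \<open>The difference of an exact solution and one with defect
  \<open>\<kappa> * \<epsilon>\<close> obeys \<open>second_order_gronwall\<close> with
  \<open>a = \<kappa> * L\<close> and \<open>b = \<kappa> * \<epsilon>\<close>. Since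
  \<open>\<kappa>\<close> is a sum over all integers, the constant does not depend on
  \<open>N\<close>. Asking for \<open>lip\<close> only along the two trajectories covers locally
  Lipschitz nonlinearities too.\<close>

lemma truncated_systems_close:
  fixes w w' z z' :: "real \<Rightarrow> int \<Rightarrow> real"
  assumes T: "0 \<le> T"
    and A: "(\<lambda>i. \<bar>A i\<bar>) summable_on UNIV" and \<kappa>: "(\<Sum>\<^sub>\<infinity>j. \<bar>A j\<bar>) = \<kappa>"
    and L: "0 \<le> L" and \<epsilon>: "0 \<le> \<epsilon>"
    and init: "\<And>i. \<bar>i\<bar> \<le> int N \<Longrightarrow> w 0 i = z 0 i \<and> w' 0 i = z' 0 i"
    and w: "\<And>i t. \<bar>i\<bar> \<le> int N \<Longrightarrow> t \<in> {0..T} \<Longrightarrow>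
      ((\<lambda>s. w s i) has_real_derivative w' t i) (at t within {0..T}) \<and>
      ((\<lambda>s. w' s i) has_real_derivative (\<Sum>j = - int N..int N. A (i - j) * g (w t j))) (at t within {0..T})"
    and z: "\<And>i t. \<bar>i\<bar> \<le> int N \<Longrightarrow> t \<in> {0..T} \<Longrightarrow>
      ((\<lambda>s. z s i) has_real_derivative z' t i) (at t within {0..T}) \<and>
      ((\<lambda>s. z' s i) has_real_derivative z'' t i) (at t within {0..T})"
    and defect: "\<And>i t. \<bar>i\<bar> \<le> int N \<Longrightarrow> t \<in> {0..T} \<Longrightarrow>
      \<bar>z'' t i - (\<Sum>j = - int N..int N. A (i - j) * g (z t j))\<bar> \<le> \<kappa> * \<epsilon>"
    and lip: "\<And>j t. \<bar>j\<bar> \<le> int N \<Longrightarrow> t \<in> {0..T} \<Longrightarrow> \<bar>g (w t j) - g (z t j)\<bar> \<le> L * \<bar>w t j - z t j\<bar>"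
    and i: "\<bar>i\<bar> \<le> int N" and t: "t \<in> {0..T}"
  shows "\<bar>w t i - z t i\<bar> \<le> (2 * T\<^sup>2 * exp ((1 + \<kappa> * L) * T) + T) * (\<kappa> * \<epsilon>)"
    and "\<bar>w' t i - z' t i\<bar> \<le> (2 * T\<^sup>2 * exp ((1 + \<kappa> * L) * T) + T) * (\<kappa> * \<epsilon>)"
proof -
  let ?J = "{- int N..int N}"
  have J: "j \<in> ?J \<longleftrightarrow> \<bar>j\<bar> \<le> int N" for j by auto
  have \<kappa>0: "0 \<le> \<kappa>" unfolding \<kappa> [symmetric] by (rule infsum_nonneg) simp
  note gw = second_order_gronwall [where I = ?J and T = T and a = "\<kappa> * L" and b = "\<kappa> * \<epsilon>"
      and e = "\<lambda>i t. w t i - z t i" and e' = "\<lambda>i t. w' t i - z' t i"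
      and e'' = "\<lambda>i t. (\<Sum>j\<in>?J. A (i - j) * g (w t j)) - z'' t i"]
  have bound: "\<bar>(\<Sum>j\<in>?J. A (i - j) * g (w t j)) - z'' t i\<bar> \<le> \<kappa> * L * m + \<kappa> * \<epsilon>"
    if i: "i \<in> ?J" and t: "t \<in> {0..T}" and m: "\<forall>j\<in>?J. \<bar>w t j - z t j\<bar> \<le> m" for i t m
  proof -
    have m0: "0 \<le> m" using m i by (meson abs_ge_zero order_trans)
    have "\<bar>\<Sum>j\<in>?J. A (i - j) * (g (w t j) - g (z t j))\<bar> \<le> \<kappa> * (L * m)"
      unfolding \<kappa> [symmetric]
    proof (rule finite_convolution_bound [OF A])
      fix j assume j: "j \<in> ?J"
      then have "\<bar>g (w t j) - g (z t j)\<bar> \<le> L * \<bar>w t j - z t j\<bar>" using lip t J by blast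
      also have "\<dots> \<le> L * m" using m j L by (intro mult_left_mono) auto
      finally show "\<bar>g (w t j) - g (z t j)\<bar> \<le> L * m" .
    qed (use L m0 in auto)
    then have "\<bar>(\<Sum>j\<in>?J. A (i - j) * g (w t j)) - (\<Sum>j\<in>?J. A (i - j) * g (z t j))\<bar> \<le> \<kappa> * (L * m)"
      by (simp add: right_diff_distrib sum_subtractf)
    moreover have "\<bar>z'' t i - (\<Sum>j\<in>?J. A (i - j) * g (z t j))\<bar> \<le> \<kappa> * \<epsilon>"
      using defect i t J by blast
    ultimately show ?thesis by (simp add: mult.assoc)
  qed
  have d: "((\<lambda>t. w t i - z t i) has_real_derivative w' t i - z' t i) (at t within {0..T})"
    "((\<lambda>t. w' t i - z' t i) has_real_derivative
       (\<Sum>j\<in>?J. A (i - j) * g (w t j)) - z'' t i) (at t within {0..T})"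
    if "i \<in> ?J" "t \<in> {0..T}" for i t
    using w [of i t] z [of i t] that J by (auto intro!: DERIV_diff)
  show "\<bar>w t i - z t i\<bar> \<le> (2 * T\<^sup>2 * exp ((1 + \<kappa> * L) * T) + T) * (\<kappa> * \<epsilon>)"
    by (rule gw(1)) (use \<kappa>0 L \<epsilon> init J bound d i t in auto)
  show "\<bar>w' t i - z' t i\<bar> \<le> (2 * T\<^sup>2 * exp ((1 + \<kappa> * L) * T) + T) * (\<kappa> * \<epsilon>)"
    by (rule gw(2)) (use \<kappa>0 L \<epsilon> init J bound d i t in auto)
qed

section \<open>Local Lipschitz continuity and uniqueness for the truncated system\<close>

lemma locally_lipschitz_on_interval:
  fixes f :: "real \<Rightarrow> real"
  assumes "local_lipschitz (UNIV :: real set) UNIV (\<lambda>_. f)"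
  obtains L where "L-lipschitz_on {- R..R} f"
proof -
  have "local_lipschitz (UNIV :: real set) {- R..R} (\<lambda>_. f)"
    using assms by (rule local_lipschitz_subset) auto
  \<comment> \<open>The dummy time parameter is confined to a single point so that both sets are
    compact.\<close>
  then have "local_lipschitz {0 :: real} {- R..R} (\<lambda>_. f)"
    by (rule local_lipschitz_subset) auto
  from local_lipschitz_compact_implies_lipschitz [OF this] that show thesis by auto
qed

lemma solves_truncated_systemD:
  assumes "solves_truncated_system \<beta> f h T N a b w w'" and "\<bar>i\<bar> \<le> int N"
  shows "w 0 i = a i" and "w' 0 i = b i"
    and "t \<in> {0..T} \<Longrightarrow> ((\<lambda>s. w s i) has_real_derivative w' t i) (at t within {0..T}) \<and>
      ((\<lambda>s. w' s i) has_real_derivative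
        (\<Sum>j = - int N..int N.
          h * forward_diff h (backward_diff h (grid_restriction h \<beta>)) (i - j) * f (w t j)))
        (at t within {0..T})"
proof -
  have "i \<in> {- int N..int N}" using assms(2) by auto
  with assms(1) show "w 0 i = a i" "w' 0 i = b i"
    "t \<in> {0..T} \<Longrightarrow> ((\<lambda>s. w s i) has_real_derivative w' t i) (at t within {0..T}) \<and>
      ((\<lambda>s. w' s i) has_real_derivative
        (\<Sum>j = - int N..int N.
          h * forward_diff h (backward_diff h (grid_restriction h \<beta>)) (i - j) * f (w t j)))
        (at t within {0..T})"
    unfolding solves_truncated_system_def by blast+
qed

text \<open>Two solutions on a compact time interval stay in a common bounded range, where
  \<open>f\<close> has a Lipschitz constant. The stability estimate with zero defect then forces
  them to coincide.\<close>

lemma truncated_system_unique: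
  fixes f :: "real \<Rightarrow> real"
  assumes f: "local_lipschitz (UNIV :: real set) UNIV (\<lambda>_. f)" and T: "0 \<le> T"
    and A: "(\<lambda>i. \<bar>h * forward_diff h (backward_diff h (grid_restriction h \<beta>)) i\<bar>) summable_on UNIV"
    and w: "solves_truncated_system \<beta> f h T N a b w w'"
    and z: "solves_truncated_system \<beta> f h T N a b z z'"
    and i: "\<bar>i\<bar> \<le> int N" and t: "t \<in> {0..T}"
  shows "w t i = z t i" and "w' t i = z' t i"
proof -
  let ?J = "{- int N..int N}"
  have "\<exists>B. \<forall>t\<in>{0..T}. \<forall>i\<in>?J. \<bar>u t i\<bar> \<le> B"
    if u: "solves_truncated_system \<beta> f h T N a b u u'" for u u'
  proof -
    have "compact ((\<lambda>t. u t i) ` {0..T})" if "i \<in> ?J" for i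
      using u that unfolding solves_truncated_system_def
      by (intro compact_continuous_image DERIV_continuous_on [where D = "\<lambda>t. u' t i"]) auto
    then have "bounded (\<Union>i\<in>?J. (\<lambda>t. u t i) ` {0..T})"
      by (intro compact_imp_bounded compact_UN) auto
    then show ?thesis unfolding bounded_iff by auto
  qed
  from this [OF w] this [OF z] obtain B B'
    where B: "\<And>t i. t \<in> {0..T} \<Longrightarrow> i \<in> ?J \<Longrightarrow> \<bar>w t i\<bar> \<le> B"
      and B': "\<And>t i. t \<in> {0..T} \<Longrightarrow> i \<in> ?J \<Longrightarrow> \<bar>z t i\<bar> \<le> B'" by metis
  obtain L where L: "L-lipschitz_on {- max B B'..max B B'} f"
    using locally_lipschitz_on_interval [OF f] .
  have lip: "\<bar>f (w t j) - f (z t j)\<bar> \<le> L * \<bar>w t j - z t j\<bar>" if "\<bar>j\<bar> \<le> int N" "t \<in> {0..T}" for j t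
  proof -
    have "\<bar>w t j\<bar> \<le> B" "\<bar>z t j\<bar> \<le> B'"
      using that by (intro B B'; simp add: abs_le_iff; linarith)+
    then have "w t j \<in> {- max B B'..max B B'}" "z t j \<in> {- max B B'..max B B'}" by auto
    from lipschitz_onD [OF L this] show ?thesis by (simp add: dist_real_def)
  qed
  have init: "w 0 i = z 0 i \<and> w' 0 i = z' 0 i" if "\<bar>i\<bar> \<le> int N" for i
    using solves_truncated_systemD(1,2) [OF w that] solves_truncated_systemD(1,2) [OF z that] by simp
  note close = truncated_systems_close [where \<epsilon> = 0, OF T A refl lipschitz_on_nonneg [OF L] order_refl
      init solves_truncated_systemD(3) [OF w] solves_truncated_systemD(3) [OF z] _ lip i t]
  have "\<bar>w t i - z t i\<bar> \<le> 0" "\<bar>w' t i - z' t i\<bar> \<le> 0"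
    using close by simp_all
  then show "w t i = z t i" "w' t i = z' t i" by auto
qed

section \<open>Suprema over the tail and extension of the nonlinearity\<close>

lemma max_abs_on_upper:
  assumes f: "continuous_on UNIV f" and "\<bar>z\<bar> \<le> d"
  shows "\<bar>f z\<bar> \<le> max_abs_on f d"
  unfolding max_abs_on_def
proof (rule cSup_upper)
  have "compact ((\<lambda>z. \<bar>f z\<bar>) ` {- d..d})"
    by (intro compact_continuous_image continuous_intros continuous_on_subset [OF f]) auto
  then have "bdd_above ((\<lambda>z. \<bar>f z\<bar>) ` {- d..d})"
    by (intro bounded_imp_bdd_above compact_imp_bounded)
  also have "(\<lambda>z. \<bar>f z\<bar>) ` {- d..d} = {\<bar>f z\<bar> |z. \<bar>z\<bar> \<le> d}" by (auto simp: abs_le_iff)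
  finally show "bdd_above {\<bar>f z\<bar> |z. \<bar>z\<bar> \<le> d}" .
qed (use assms(2) in auto)

lemma tail_sup_upper:
  assumes M: "\<And>t. t \<in> {0..T} \<Longrightarrow> norm (v t) \<le> M" and "t \<in> {0..T}" "\<bar>i\<bar> > int N"
  shows "\<bar>apply_bcontfun (v t) i\<bar> \<le> tail_sup T v N"
  unfolding tail_sup_def
proof (rule cSup_upper)
  show "bdd_above {\<bar>apply_bcontfun (v t) i\<bar> |t i. t \<in> {0..T} \<and> \<bar>i\<bar> > int N}"
    by (rule bdd_aboveI [where M = M])
      (use M norm_bounded order_trans in \<open>fastforce simp flip: real_norm_def\<close>)
qed (use assms in auto)

text \<open>Projection onto an interval does not increase distances, so the constant
  \<open>L\<close> survives.\<close>

lemma lipschitz_clip: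
  fixes f :: "real \<Rightarrow> real"
  assumes f: "L-lipschitz_on {- R..R} f" and R: "0 \<le> R"
  shows "L-lipschitz_on UNIV (\<lambda>z. f (max (- R) (min z R)))"
proof (rule lipschitz_onI)
  fix x y :: real
  have "dist (f (max (- R) (min x R))) (f (max (- R) (min y R)))
      \<le> L * dist (max (- R) (min x R)) (max (- R) (min y R))"
    using R by (intro lipschitz_onD [OF f]) auto
  also have "\<dots> \<le> L * dist x y"
    using lipschitz_on_nonneg [OF f] by (intro mult_left_mono) (auto simp: dist_real_def)
  finally show "dist (f (max (- R) (min x R))) (f (max (- R) (min y R))) \<le> L * dist x y" .
qed (rule lipschitz_on_nonneg [OF f])

section \<open>Comparison of the truncated system with the infinite lattice\<close>

theorem theorem5p1:
  fixes \<beta> f :: "real \<Rightarrow> real"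
    and \<mu>p \<mu>n :: "real measure"
    and h T :: real
    and v v' :: "real \<Rightarrow> int \<Rightarrow>\<^sub>C real"
  assumes "\<And>x. \<beta> (- x) = \<beta> x"
    and "(LINT x|lborel. \<beta> x) = 1"
    and "sobolev_W11 \<beta>"
    and "continuous_on UNIV \<beta>"
    and "second_derivative_measure \<beta> \<mu>p \<mu>n"
    and "local_lipschitz (UNIV :: real set) UNIV (\<lambda>_. f)"
    and "f 0 = 0"
    and "h > 0"
    and "T > 0"
    and "solves_lattice_system \<beta> f h T v v'"
  shows "\<exists>\<epsilon>0 C. \<epsilon>0 > 0 \<and> C > 0 \<and>
    (\<forall>N::nat. N \<ge> 1 \<longrightarrow> max_abs_on f (tail_sup T v N) \<le> \<epsilon>0 \<longrightarrow>
      (\<exists>w w'. solves_truncated_system \<beta> f h T N (truncation N (v 0)) (truncation N (v' 0)) w w') \<and>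
      (\<forall>w w'. solves_truncated_system \<beta> f h T N (truncation N (v 0)) (truncation N (v' 0)) w w' \<longrightarrow>
        (\<forall>t\<in>{0..T}. \<forall>i\<in>{- int N..int N}.
          \<bar>w t i - apply_bcontfun (v t) i\<bar> + \<bar>w' t i - apply_bcontfun (v' t) i\<bar>
            \<le> C * max_abs_on f (tail_sup T v N))))"
proof -
  note W = assms(3) and cont = assms(4) and f = assms(6) and f0 = \<open>f 0 = 0\<close>
    and h = \<open>h > 0\<close> and T = \<open>T > 0\<close> and sol = assms(10)
  let ?V = "\<lambda>t i. apply_bcontfun (v t) i"
  let ?V' = "\<lambda>t i. apply_bcontfun (v' t) i"
  define A where "A = (\<lambda>i. h * forward_diff h (backward_diff h (grid_restriction h \<beta>)) i)"
  define \<kappa> where "\<kappa> = (\<Sum>\<^sub>\<infinity>j. \<bar>A j\<bar>)"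
  have b: "(\<lambda>i. \<bar>grid_restriction h \<beta> i\<bar>) summable_on UNIV"
    by (rule sobolev_W11_grid_summable [OF W cont h])
  have A: "(\<lambda>i. \<bar>A i\<bar>) summable_on UNIV"
    unfolding A_def by (rule second_diff_summable [OF b])
  have \<kappa>0: "0 \<le> \<kappa>" unfolding \<kappa>_def by (rule infsum_nonneg) simp
  obtain v'' where C2: "C2_derivatives_on {0..T} v v' v''"
    and v'': "\<And>t i. t \<in> {0..T} \<Longrightarrow> apply_bcontfun (v'' t) i =
      forward_diff h (backward_diff h (discrete_conv h (grid_restriction h \<beta>) (\<lambda>j. f (?V t j)))) i"
    using sol by (auto simp: solves_lattice_system_def)
  have dv: "((\<lambda>s. ?V s i) has_real_derivative ?V' t i) (at t within {0..T}) \<and>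
      ((\<lambda>s. ?V' s i) has_real_derivative apply_bcontfun (v'' t) i) (at t within {0..T})"
    if "t \<in> {0..T}" for t i
    using C2 that bounded_linear.has_vector_derivative [OF bounded_linear_apply_bcontfun [of i]]
    unfolding C2_derivatives_on_def has_real_derivative_iff_has_vector_derivative by blast
  have "continuous_on {0..T} v"
    using C2 unfolding C2_derivatives_on_def
    by (intro continuous_on_vector_derivative) auto
  then have "bounded (v ` {0..T})"
    by (intro compact_imp_bounded compact_continuous_image) auto
  then obtain M where "\<forall>t\<in>{0..T}. norm (v t) \<le> M"
    unfolding bounded_iff by auto
  then have M: "norm (v t) \<le> M" if "t \<in> {0..T}" for t using that by blast
  have VM: "\<bar>?V t i\<bar> \<le> M" if "t \<in> {0..T}" for t i
    using norm_bounded [of "v t" i] M [OF that] by simp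
  have M0: "0 \<le> M" using VM [of 0 0] T by (simp add: order_trans [OF abs_ge_zero])
  \<comment> \<open>The margin 1 above the bound for \<open>v\<close> is the room in which the
    truncated solution may deviate.\<close>
  define R where "R = M + 1"
  have R: "0 \<le> R" using M0 by (simp add: R_def)
  obtain L where L: "L-lipschitz_on {- R..R} f"
    using locally_lipschitz_on_interval [OF f] .
  have L0: "0 \<le> L" using L by (rule lipschitz_on_nonneg)
  define g where "g = (\<lambda>z. f (max (- R) (min z R)))"
  have g: "L-lipschitz_on UNIV g" unfolding g_def by (rule lipschitz_clip [OF L R])
  have gf: "g z = f z" if "\<bar>z\<bar> \<le> R" for z using that by (simp add: g_def)
  have f_cont: "continuous_on UNIV f"
    by (rule local_lipschitz_continuous_on [OF f]) simp
  define c where "c = (2 * T\<^sup>2 * exp ((1 + \<kappa> * L) * T) + T) * \<kappa>"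
  have c: "0 \<le> c" unfolding c_def using T \<kappa>0 by (intro mult_nonneg_nonneg add_nonneg_nonneg) auto
  \<comment> \<open>Chosen so that \<open>c * \<epsilon>0 \<le> 1\<close>, the margin between
    \<open>M\<close> and \<open>R\<close>.\<close>
  define \<epsilon>0 where "\<epsilon>0 = 1 / (c + 1)"
  \<comment> \<open>One \<open>c\<close> each for position and velocity; the added 1 keeps
    \<open>C\<close> positive when \<open>c = 0\<close>.\<close>
  define C where "C = 2 * c + 1"
  have "(\<exists>w w'. solves_truncated_system \<beta> f h T N (truncation N (v 0)) (truncation N (v' 0)) w w') \<and>
      (\<forall>w w'. solves_truncated_system \<beta> f h T N (truncation N (v 0)) (truncation N (v' 0)) w w' \<longrightarrow>
        (\<forall>t\<in>{0..T}. \<forall>i\<in>{- int N..int N}.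
          \<bar>w t i - ?V t i\<bar> + \<bar>w' t i - ?V' t i\<bar> \<le> C * max_abs_on f (tail_sup T v N)))"
    if small: "max_abs_on f (tail_sup T v N) \<le> \<epsilon>0" for N
  proof -
    let ?J = "{- int N..int N}"
    define \<epsilon> where "\<epsilon> = max_abs_on f (tail_sup T v N)"
    have tail: "\<bar>f (?V t j)\<bar> \<le> \<epsilon>" if "t \<in> {0..T}" "j \<notin> ?J" for t j
      unfolding \<epsilon>_def
      by (intro max_abs_on_upper f_cont tail_sup_upper [OF M]) (use that in auto)
    \<comment> \<open>The index \<open>int N + 1\<close> is a sample outside the window, from which
      the supremum is seen to be nonnegative.\<close>
    have "0 \<le> \<bar>f (?V 0 (int N + 1))\<bar>" by simp
    also have "\<dots> \<le> \<epsilon>" using tail T by auto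
    finally have \<epsilon>: "0 \<le> \<epsilon>" .
    obtain w w' where w: "solves_truncated_system \<beta> g h T N (truncation N (v 0)) (truncation N (v' 0)) w w'"
      using truncated_system_solution_exists [OF g] T by (meson less_imp_le)
    \<comment> \<open>The lattice solution satisfies the truncated equation up to the part of the
      convolution outside the window. On the range of \<open>v\<close> the functions
      \<open>f\<close> and \<open>g\<close> agree.\<close>
    have defect: "\<bar>apply_bcontfun (v'' t) i - (\<Sum>j\<in>?J. A (i - j) * g (?V t j))\<bar> \<le> \<kappa> * \<epsilon>"
      if t: "t \<in> {0..T}" for i t
    proof -
      have fB: "\<bar>f (?V t j)\<bar> \<le> max_abs_on f M" for j
        using VM [OF t] by (intro max_abs_on_upper f_cont)
      have "apply_bcontfun (v'' t) i = (\<Sum>\<^sub>\<infinity>j. A (i - j) * f (?V t j))"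
        unfolding A_def v'' [OF t] by (rule second_diff_discrete_conv [OF b fB])
      moreover have "(\<Sum>j\<in>?J. A (i - j) * g (?V t j)) = (\<Sum>j\<in>?J. A (i - j) * f (?V t j))"
        using VM [OF t] by (intro sum.cong refl) (simp add: gf R_def add_increasing2)
      ultimately show ?thesis
        using infsum_convolution_truncation_bound [OF A finite_atLeastAtMost_int fB tail [OF t] \<epsilon>, where i = i]
        by (simp add: \<kappa>_def)
    qed
    have lip: "\<bar>g x - g y\<bar> \<le> L * \<bar>x - y\<bar>" for x y
      using lipschitz_onD [OF g, of x y] by (simp add: dist_real_def)
    have close: "\<bar>w t i - ?V t i\<bar> \<le> c * \<epsilon>" "\<bar>w' t i - ?V' t i\<bar> \<le> c * \<epsilon>"
      if "t \<in> {0..T}" "i \<in> ?J" for t i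
    proof -
      note cl = truncated_systems_close [where g = g and \<epsilon> = \<epsilon> and L = L and N = N and T = T
          and w = w and w' = w' and z = ?V and z' = ?V' and t = t and i = i
          and z'' = "\<lambda>t i. apply_bcontfun (v'' t) i", OF less_imp_le [OF T] A \<kappa>_def [symmetric] L0 \<epsilon>]
      have init: "w 0 i = ?V 0 i \<and> w' 0 i = ?V' 0 i" if "\<bar>i\<bar> \<le> int N" for i
        using solves_truncated_systemD(1,2) [OF w that] that by (auto simp: truncation_def abs_le_iff)
      have der: "((\<lambda>s. w s i) has_real_derivative w' t i) (at t within {0..T}) \<and>
          ((\<lambda>s. w' s i) has_real_derivative (\<Sum>j\<in>?J. A (i - j) * g (w t j))) (at t within {0..T})"
        if "\<bar>i\<bar> \<le> int N" "t \<in> {0..T}" for i t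
        using solves_truncated_systemD(3) [OF w that] by (simp only: A_def)
      show "\<bar>w t i - ?V t i\<bar> \<le> c * \<epsilon>" "\<bar>w' t i - ?V' t i\<bar> \<le> c * \<epsilon>"
        using cl [OF init der dv defect lip] that by (auto simp: c_def mult.assoc)
    qed
    \<comment> \<open>The modified solution exists on all of \<open>{0..T}\<close>, so the bound
      applies at every time at once and confines \<open>w\<close> to the range where
      \<open>g\<close> is \<open>f\<close>; no continuation argument is required.\<close>
    have "c * \<epsilon> \<le> c * \<epsilon>0" using small c unfolding \<epsilon>_def by (intro mult_left_mono)
    also have "\<dots> \<le> 1" using c by (simp add: \<epsilon>0_def)
    finally have "\<bar>w t i\<bar> \<le> R" if "t \<in> {0..T}" "i \<in> ?J" for t i
      using close(1) [OF that] VM [OF that(1), of i] by (simp add: R_def)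
    then have "(\<Sum>j\<in>?J. a j * g (w t j)) = (\<Sum>j\<in>?J. a j * f (w t j))" if "t \<in> {0..T}" for t a
      using that by (intro sum.cong refl) (simp add: gf)
    then have wf: "solves_truncated_system \<beta> f h T N (truncation N (v 0)) (truncation N (v' 0)) w w'"
      using w by (simp add: solves_truncated_system_def)
    have "\<bar>u t i - ?V t i\<bar> + \<bar>u' t i - ?V' t i\<bar> \<le> C * \<epsilon>"
      if u: "solves_truncated_system \<beta> f h T N (truncation N (v 0)) (truncation N (v' 0)) u u'"
        and t: "t \<in> {0..T}" and i: "i \<in> ?J" for u u' t i
    proof -
      have "u t i = w t i" "u' t i = w' t i"
        using truncated_system_unique [OF f less_imp_le [OF T] A [unfolded A_def] u wf _ t] i by auto
      then show ?thesis using close [OF t i] \<epsilon> by (simp add: C_def algebra_simps)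
    qed
    with wf show ?thesis unfolding \<epsilon>_def by blast
  qed
  moreover have "\<epsilon>0 > 0" "C > 0" using c by (auto simp: \<epsilon>0_def C_def)
  ultimately show ?thesis by blast
qed

end
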